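(* Let $\mathcal{C}$ be a variety and $A$ a member of $\mathcal{C}$ such that $[\cdot,\cdot]_A$ is commutative and distributive with respect to arbitrary joins and $\nabla_A\in\mathcal{K}(A)$. Let $M$ be an algebra from $\mathcal{C}$ such that the direct product $A\times M$ has no skew congruences. Then: (1) for all $\emptyset\neq X\subseteq A^2$ and all $\emptyset\neq Y\subseteq M^2$, $Cg_{A\times M}(X\times Y)=Cg_A(X)\times Cg_M(Y)$, and the map $(\alpha,\mu)\mapsto\alpha\times\mu$ is a lattice isomorphism from $\mathrm{Con}(A)\times\mathrm{Con}(M)$ to $\mathrm{Con}(A\times M)$; (2) $\mathrm{PCon}(A\times M)=\{\alpha\times\mu\mid\alpha\in\mathrm{PCon}(A),\mu\in\mathrm{PCon}(M)\}$ and $\mathcal{K}(A\times M)=\{\alpha\times\mu\mid\alpha\in\mathcal{K}(A),\mu\in\mathcal{K}(M)\}$. If, moreover, $\mathcal{C}$ is congruence-modular and $\nabla_M\in\mathcal{K}(M)$, then: (3) for all $\alpha\in\mathrm{Con}(A)$ and all $\mu\in\mathrm{Con}(M)$, $\rho_{A\times M}(\alpha\times\mu)=\rho_A(\alpha)\times\rho_M(\mu)$; (4) $\equiv_{A\times M}$ equals $\equiv_A\times\equiv_M$, that is, for all $\alpha,\beta\in\mathrm{Con}(A)$ and $\mu,\nu\in\mathrm{Con}(M)$: $\alpha\times\mu\equiv_{A\times M}\beta\times\nu$ iff $\alpha\equiv_A\beta$ and $\mu\equiv_M\nu$; and, if $\mathcal{K}(A)$ and $\mathcal{K}(M)$ are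 closed with respect to the commutators of $A$ and $M$ respectively, then the lattices $\mathcal{L}(A\times M)$ and $\mathcal{L}(A)\times\mathcal{L}(M)$ are isomorphic.
   Context: $\mathcal{C}$ is a variety (equational class) of algebras of some signature $\tau$; it is congruence-modular iff the congruence lattice of each member is modular. For an algebra $N$, $\mathrm{Con}(N)$ is the complete lattice of congruences of $N$, with meet $\cap$, join $\vee$, least element $\Delta_N$ and greatest element $\nabla_N=N^2$. $Cg_N(X)$ is the congruence of $N$ generated by $X\subseteq N^2$; $\mathrm{PCon}(N)$ is the set of principal congruences $Cg_N(\{(a,b)\})$, and $\mathcal{K}(N)$ the set of finitely generated (equivalently, compact) congruences. For $X\subseteq A^2$, $Y\subseteq M^2$, $X\times Y$ denotes the product of binary relations: $X\times Y=\{((a,u),(b,v))\mid(a,b)\in X,(u,v)\in Y\}\subseteq(A\times M)^2$. $A\times M$ has no skew congruences iff $\mathrm{Con}(A\times M)=\{\alpha\times\mu\mid\alpha\in\mathrm{Con}(A),\mu\in\mathrm{Con}(M)\}$. Commutator: for $\alpha,\beta,\mu\in\mathrm{Con}(N)$, $C(\alpha,\beta;\mu)$ means: for all $n,k\in\mathbb{N}$ and every term $t$ of arity $n+k$, if $(a_i,b_i)\in\alpha$ for $1\le i\le n$ and $(c_j,d_j)\in\beta$ for $1\le j\le k$, then $(t^N(\vec a,\vec c),t^N(\vec a,\vec d))\in\mu$ iff $(t^N(\vec b,\vec c),t^N(\vec b,\vec d))\in\mu$. Put $[\alpha,\beta]_N=\bigcap\{\mu\mid C(\alpha,\beta;\mu)\}$.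 "Distributive with respect to arbitrary joins" means $[\bigvee_i\alpha_i,\bigvee_j\beta_j]_N=\bigvee_i\bigvee_j[\alpha_i,\beta_j]_N$; in congruence-modular varieties all commutators are commutative and distributive with respect to arbitrary joins. A congruence $\phi\neq\nabla_N$ is prime iff $[\alpha,\beta]_N\subseteq\phi$ implies $\alpha\subseteq\phi$ or $\beta\subseteq\phi$, for all $\alpha,\beta\in\mathrm{Con}(N)$; $\mathrm{Spec}(N)$ is the set of prime congruences; $\rho_N(\theta)=\bigcap\{\phi\in\mathrm{Spec}(N)\mid\theta\subseteq\phi\}$ (empty intersection $=\nabla_N$); $\alpha\equiv_N\beta$ iff $\rho_N(\alpha)=\rho_N(\beta)$; $\widehat\alpha$ is the $\equiv_N$-class of $\alpha$. $\mathcal{L}(N)=\{\widehat\alpha\mid\alpha\in\mathcal{K}(N)\}$, with $\widehat\alpha\vee\widehat\beta=\widehat{\alpha\vee\beta}$, $\widehat\alpha\wedge\widehat\beta=\widehat{[\alpha,\beta]_N}$, $\mathbf 0=\widehat{\Delta_N}$, $\mathbf 1=\widehat{\nabla_N}$ (a bounded distributive lattice when the commutator of $N$ is commutative and distributive with respect to arbitrary joins, $\nabla_N\in\mathcal{K}(N)$ and $\mathcal{K}(N)$ is closed under the commutator). *)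

theory Defs
  imports Main
begin

section \<open>Signatures, algebras, terms and varieties\<close>

text \<open>
  A finitary signature is a partial map \<open>\<tau> :: 'f \<rightharpoonup> nat\<close>: its operation symbols are the
  elements of \<open>dom \<tau>\<close>, and \<open>\<tau> f = Some n\<close> says that \<open>f\<close> has arity \<open>n\<close>. The set of symbols may
  be empty and nullary symbols are allowed. Algebras are nonempty.
\<close>

record ('f, 'a) algebra =
  carrier :: "'a set"
  oper :: "'f \<Rightarrow> 'a list \<Rightarrow> 'a"

definition is_algebra :: "('f \<rightharpoonup> nat) \<Rightarrow> ('f, 'a) algebra \<Rightarrow> bool" where
  "is_algebra \<tau> N \<longleftrightarrow> carrier N \<noteq> {} \<and>
     (\<forall>f xs. \<tau> f = Some (length xs) \<and> set xs \<subseteq> carrier N \<longrightarrow> oper N f xs \<in> carrier N)"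

datatype 'f trm = Var nat | App 'f "'f trm list"

primrec wf_trm :: "('f \<rightharpoonup> nat) \<Rightarrow> 'f trm \<Rightarrow> bool" where
  "wf_trm \<tau> (Var i) \<longleftrightarrow> True"
| "wf_trm \<tau> (App f ts) \<longleftrightarrow> \<tau> f = Some (length ts) \<and> list_all (wf_trm \<tau>) ts"

primrec vars :: "'f trm \<Rightarrow> nat set" where
  "vars (Var i) = {i}"
| "vars (App f ts) = \<Union> (set (map vars ts))"

primrec eval_trm :: "('f, 'a) algebra \<Rightarrow> (nat \<Rightarrow> 'a) \<Rightarrow> 'f trm \<Rightarrow> 'a" where
  "eval_trm N v (Var i) = v i"
| "eval_trm N v (App f ts) = oper N f (map (eval_trm N v) ts)"

definition is_identities :: "('f \<rightharpoonup> nat) \<Rightarrow> ('f trm \<times> 'f trm) set \<Rightarrow> bool" where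
  "is_identities \<tau> E \<longleftrightarrow> (\<forall>(s, t) \<in> E. wf_trm \<tau> s \<and> wf_trm \<tau> t)"

text \<open>
  A variety is given by its signature and a set of identities; \<open>variety \<tau> E\<close> consists of its
  members whose carrier is a subset of the type \<open>'a\<close>.
\<close>

definition variety :: "('f \<rightharpoonup> nat) \<Rightarrow> ('f trm \<times> 'f trm) set \<Rightarrow> ('f, 'a) algebra set" where
  "variety \<tau> E = {N. is_algebra \<tau> N \<and>
     (\<forall>(s, t) \<in> E. \<forall>v. range v \<subseteq> carrier N \<longrightarrow> eval_trm N v s = eval_trm N v t)}"

definition prod_algebra :: "('f, 'a) algebra \<Rightarrow> ('f, 'm) algebra \<Rightarrow> ('f, 'a \<times> 'm) algebra" where
  "prod_algebra A M = \<lparr>carrier = carrier A \<times> carrier M,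
     oper = (\<lambda>f xs. (oper A f (map fst xs), oper M f (map snd xs)))\<rparr>"

definition rel_times :: "('a \<times> 'a) set \<Rightarrow> ('m \<times> 'm) set \<Rightarrow> (('a \<times> 'm) \<times> ('a \<times> 'm)) set"
    (infixr "\<otimes>\<^sub>r" 80) where
  "X \<otimes>\<^sub>r Y = {((a, u), (b, v)) | a u b v. (a, b) \<in> X \<and> (u, v) \<in> Y}"


section \<open>Congruences\<close>

definition Con :: "('f \<rightharpoonup> nat) \<Rightarrow> ('f, 'a) algebra \<Rightarrow> ('a \<times> 'a) set set" where
  "Con \<tau> N = {\<theta>. equiv (carrier N) \<theta> \<and>
     (\<forall>f xs ys. \<tau> f = Some (length xs) \<and> list_all2 (\<lambda>x y. (x, y) \<in> \<theta>) xs ys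
        \<longrightarrow> (oper N f xs, oper N f ys) \<in> \<theta>)}"

definition con_bot :: "('f, 'a) algebra \<Rightarrow> ('a \<times> 'a) set" where
  "con_bot N = Id_on (carrier N)"

definition con_top :: "('f, 'a) algebra \<Rightarrow> ('a \<times> 'a) set" where
  "con_top N = carrier N \<times> carrier N"

definition Cg :: "('f \<rightharpoonup> nat) \<Rightarrow> ('f, 'a) algebra \<Rightarrow> ('a \<times> 'a) set \<Rightarrow> ('a \<times> 'a) set" where
  "Cg \<tau> N X = \<Inter> {\<theta> \<in> Con \<tau> N. X \<subseteq> \<theta>}"

text \<open>The join of a set \<open>S\<close> of congruences: the least congruence above all members of \<open>S\<close>.\<close>

definition con_Join :: "('f \<rightharpoonup> nat) \<Rightarrow> ('f, 'a) algebra \<Rightarrow> ('a \<times> 'a) set set \<Rightarrow> ('a \<times> 'a) set" where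
  "con_Join \<tau> N S = \<Inter> {\<theta> \<in> Con \<tau> N. \<forall>\<alpha>\<in>S. \<alpha> \<subseteq> \<theta>}"

definition con_join ::
    "('f \<rightharpoonup> nat) \<Rightarrow> ('f, 'a) algebra \<Rightarrow> ('a \<times> 'a) set \<Rightarrow> ('a \<times> 'a) set \<Rightarrow> ('a \<times> 'a) set" where
  "con_join \<tau> N \<alpha> \<beta> = con_Join \<tau> N {\<alpha>, \<beta>}"

definition PCon :: "('f \<rightharpoonup> nat) \<Rightarrow> ('f, 'a) algebra \<Rightarrow> ('a \<times> 'a) set set" where
  "PCon \<tau> N = {Cg \<tau> N {(a, b)} | a b. a \<in> carrier N \<and> b \<in> carrier N}"

definition KCon :: "('f \<rightharpoonup> nat) \<Rightarrow> ('f, 'a) algebra \<Rightarrow> ('a \<times> 'a) set set" where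
  "KCon \<tau> N = {Cg \<tau> N X | X. finite X \<and> X \<subseteq> carrier N \<times> carrier N}"

definition no_skew :: "('f \<rightharpoonup> nat) \<Rightarrow> ('f, 'a) algebra \<Rightarrow> ('f, 'm) algebra \<Rightarrow> bool" where
  "no_skew \<tau> A M \<longleftrightarrow>
     Con \<tau> (prod_algebra A M) = {\<alpha> \<otimes>\<^sub>r \<mu> | \<alpha> \<mu>. \<alpha> \<in> Con \<tau> A \<and> \<mu> \<in> Con \<tau> M}"

definition con_modular :: "('f \<rightharpoonup> nat) \<Rightarrow> ('f, 'a) algebra \<Rightarrow> bool" where
  "con_modular \<tau> N \<longleftrightarrow>
     (\<forall>\<alpha>\<in>Con \<tau> N. \<forall>\<beta>\<in>Con \<tau> N. \<forall>\<gamma>\<in>Con \<tau> N. \<alpha> \<subseteq> \<gamma> \<longrightarrow>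
        con_join \<tau> N \<alpha> \<beta> \<inter> \<gamma> = con_join \<tau> N \<alpha> (\<beta> \<inter> \<gamma>))"

text \<open>
  HOL cannot quantify over the carrier types of the members of a variety. The carriers are
  therefore taken inside the type of terms, which has room for a copy of every algebra of
  cardinality at most \<open>max(\<bar>dom \<tau>\<bar>, \<aleph>\<^sub>0)\<close>, in particular of all finitely generated ones. This is no
  restriction: \<open>congruence_modular_imp_con_modular\<close> below derives modularity of \<open>Con \<tau> N\<close> for
  all members \<open>N\<close> of the variety, over every type.
\<close>

definition congruence_modular :: "('f \<rightharpoonup> nat) \<Rightarrow> ('f trm \<times> 'f trm) set \<Rightarrow> bool" where
  "congruence_modular \<tau> E \<longleftrightarrow> (\<forall>N :: ('f, 'f trm) algebra. N \<in> variety \<tau> E \<longrightarrow> con_modular \<tau> N)"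


section \<open>The commutator and prime congruences\<close>

text \<open>
  The term condition: \<open>t\<close> is a term in the variables \<open>Var 0, \<dots>, Var (n + k - 1)\<close>, the first \<open>n\<close> of
  which are evaluated at \<open>as\<close> (or \<open>bs\<close>) and the last \<open>k\<close> at \<open>cs\<close> (or \<open>ds\<close>).
\<close>

definition centralizes ::
    "('f \<rightharpoonup> nat) \<Rightarrow> ('f, 'a) algebra \<Rightarrow> ('a \<times> 'a) set \<Rightarrow> ('a \<times> 'a) set \<Rightarrow> ('a \<times> 'a) set \<Rightarrow> bool" where
  "centralizes \<tau> N \<alpha> \<beta> \<mu> \<longleftrightarrow>
     (\<forall>n k t as bs cs ds.
        wf_trm \<tau> t \<and> vars t \<subseteq> {..<n + k} \<and>
        length as = n \<and> length cs = k \<and>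
        list_all2 (\<lambda>a b. (a, b) \<in> \<alpha>) as bs \<and> list_all2 (\<lambda>c d. (c, d) \<in> \<beta>) cs ds \<longrightarrow>
        ((eval_trm N ((!) (as @ cs)) t, eval_trm N ((!) (as @ ds)) t) \<in> \<mu> \<longleftrightarrow>
         (eval_trm N ((!) (bs @ cs)) t, eval_trm N ((!) (bs @ ds)) t) \<in> \<mu>))"

definition commutator ::
    "('f \<rightharpoonup> nat) \<Rightarrow> ('f, 'a) algebra \<Rightarrow> ('a \<times> 'a) set \<Rightarrow> ('a \<times> 'a) set \<Rightarrow> ('a \<times> 'a) set" where
  "commutator \<tau> N \<alpha> \<beta> = \<Inter> {\<mu> \<in> Con \<tau> N. centralizes \<tau> N \<alpha> \<beta> \<mu>}"

definition commutator_commutative :: "('f \<rightharpoonup> nat) \<Rightarrow> ('f, 'a) algebra \<Rightarrow> bool" where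
  "commutator_commutative \<tau> N \<longleftrightarrow>
     (\<forall>\<alpha>\<in>Con \<tau> N. \<forall>\<beta>\<in>Con \<tau> N. commutator \<tau> N \<alpha> \<beta> = commutator \<tau> N \<beta> \<alpha>)"

definition commutator_distributive :: "('f \<rightharpoonup> nat) \<Rightarrow> ('f, 'a) algebra \<Rightarrow> bool" where
  "commutator_distributive \<tau> N \<longleftrightarrow>
     (\<forall>S T. S \<subseteq> Con \<tau> N \<and> T \<subseteq> Con \<tau> N \<longrightarrow>
        commutator \<tau> N (con_Join \<tau> N S) (con_Join \<tau> N T) =
        con_Join \<tau> N ((\<lambda>\<alpha>. con_Join \<tau> N ((\<lambda>\<beta>. commutator \<tau> N \<alpha> \<beta>) ` T)) ` S))"

definition KCon_commutator_closed :: "('f \<rightharpoonup> nat) \<Rightarrow> ('f, 'a) algebra \<Rightarrow> bool" where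
  "KCon_commutator_closed \<tau> N \<longleftrightarrow>
     (\<forall>\<alpha>\<in>KCon \<tau> N. \<forall>\<beta>\<in>KCon \<tau> N. commutator \<tau> N \<alpha> \<beta> \<in> KCon \<tau> N)"

definition Spec :: "('f \<rightharpoonup> nat) \<Rightarrow> ('f, 'a) algebra \<Rightarrow> ('a \<times> 'a) set set" where
  "Spec \<tau> N = {\<phi> \<in> Con \<tau> N. \<phi> \<noteq> con_top N \<and>
     (\<forall>\<alpha>\<in>Con \<tau> N. \<forall>\<beta>\<in>Con \<tau> N. commutator \<tau> N \<alpha> \<beta> \<subseteq> \<phi> \<longrightarrow> \<alpha> \<subseteq> \<phi> \<or> \<beta> \<subseteq> \<phi>)}"

text \<open>Intersecting with \<open>con_top N\<close> only makes the empty intersection equal to \<open>con_top N\<close>.\<close>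

definition radical :: "('f \<rightharpoonup> nat) \<Rightarrow> ('f, 'a) algebra \<Rightarrow> ('a \<times> 'a) set \<Rightarrow> ('a \<times> 'a) set" where
  "radical \<tau> N \<theta> = con_top N \<inter> \<Inter> {\<phi> \<in> Spec \<tau> N. \<theta> \<subseteq> \<phi>}"

definition rad_equiv ::
    "('f \<rightharpoonup> nat) \<Rightarrow> ('f, 'a) algebra \<Rightarrow> ('a \<times> 'a) set \<Rightarrow> ('a \<times> 'a) set \<Rightarrow> bool" where
  "rad_equiv \<tau> N \<alpha> \<beta> \<longleftrightarrow> radical \<tau> N \<alpha> = radical \<tau> N \<beta>"

definition rad_class :: "('f \<rightharpoonup> nat) \<Rightarrow> ('f, 'a) algebra \<Rightarrow> ('a \<times> 'a) set \<Rightarrow> ('a \<times> 'a) set set" where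
  "rad_class \<tau> N \<alpha> = {\<beta> \<in> Con \<tau> N. rad_equiv \<tau> N \<alpha> \<beta>}"


section \<open>Bounded lattices and the reticulation\<close>

record 'l blattice =
  lcarrier :: "'l set"
  ljoin :: "'l \<Rightarrow> 'l \<Rightarrow> 'l"
  lmeet :: "'l \<Rightarrow> 'l \<Rightarrow> 'l"
  lzero :: 'l
  lone :: 'l

text \<open>
  A lattice isomorphism between bounded lattices automatically preserves the bounds, so
  requiring this as well makes no difference.
\<close>

definition lattice_iso :: "('l \<Rightarrow> 'k) \<Rightarrow> 'l blattice \<Rightarrow> 'k blattice \<Rightarrow> bool" where
  "lattice_iso h L L' \<longleftrightarrow> bij_betw h (lcarrier L) (lcarrier L') \<and>
     (\<forall>x\<in>lcarrier L. \<forall>y\<in>lcarrier L.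
        h (ljoin L x y) = ljoin L' (h x) (h y) \<and> h (lmeet L x y) = lmeet L' (h x) (h y)) \<and>
     h (lzero L) = lzero L' \<and> h (lone L) = lone L'"

definition lattice_isomorphic :: "'l blattice \<Rightarrow> 'k blattice \<Rightarrow> bool" where
  "lattice_isomorphic L L' \<longleftrightarrow> (\<exists>h. lattice_iso h L L')"

definition prod_blattice :: "'l blattice \<Rightarrow> 'k blattice \<Rightarrow> ('l \<times> 'k) blattice" where
  "prod_blattice L L' = \<lparr>lcarrier = lcarrier L \<times> lcarrier L',
     ljoin = (\<lambda>(x, x') (y, y'). (ljoin L x y, ljoin L' x' y')),
     lmeet = (\<lambda>(x, x') (y, y'). (lmeet L x y, lmeet L' x' y')),
     lzero = (lzero L, lzero L'), lone = (lone L, lone L')\<rparr>"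

definition Con_lattice :: "('f \<rightharpoonup> nat) \<Rightarrow> ('f, 'a) algebra \<Rightarrow> ('a \<times> 'a) set blattice" where
  "Con_lattice \<tau> N = \<lparr>lcarrier = Con \<tau> N, ljoin = con_join \<tau> N, lmeet = (\<inter>),
     lzero = con_bot N, lone = con_top N\<rparr>"

text \<open>
  The operations on classes are given by representatives: the unions below range over equal
  sets, so \<open>\<Union>\<close> only extracts the common value; see \<open>reticulation_ljoin\<close> and
  \<open>reticulation_lmeet\<close>.
\<close>

definition reticulation :: "('f \<rightharpoonup> nat) \<Rightarrow> ('f, 'a) algebra \<Rightarrow> ('a \<times> 'a) set set blattice" where
  "reticulation \<tau> N = \<lparr>lcarrier = rad_class \<tau> N ` KCon \<tau> N,
     ljoin = (\<lambda>X Y. \<Union>\<alpha>\<in>X \<inter> KCon \<tau> N. \<Union>\<beta>\<in>Y \<inter> KCon \<tau> N. rad_class \<tau> N (con_join \<tau> N \<alpha> \<beta>)),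
     lmeet = (\<lambda>X Y. \<Union>\<alpha>\<in>X \<inter> KCon \<tau> N. \<Union>\<beta>\<in>Y \<inter> KCon \<tau> N. rad_class \<tau> N (commutator \<tau> N \<alpha> \<beta>)),
     lzero = rad_class \<tau> N (con_bot N),
     lone = rad_class \<tau> N (con_top N)\<rparr>"


section \<open>The operations of the reticulation are well defined\<close>

lemma ConD:
  assumes "\<theta> \<in> Con \<tau> N"
  shows Con_sub: "\<theta> \<subseteq> carrier N \<times> carrier N"
    and Con_refl: "x \<in> carrier N \<Longrightarrow> (x, x) \<in> \<theta>"
    and Con_sym: "(x, y) \<in> \<theta> \<Longrightarrow> (y, x) \<in> \<theta>"
    and Con_trans: "(x, y) \<in> \<theta> \<Longrightarrow> (y, z) \<in> \<theta> \<Longrightarrow> (x, z) \<in> \<theta>"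
    and Con_compat: "\<tau> f = Some (length xs) \<Longrightarrow> list_all2 (\<lambda>x y. (x, y) \<in> \<theta>) xs ys \<Longrightarrow>
      (oper N f xs, oper N f ys) \<in> \<theta>"
  using assms unfolding Con_def equiv_def refl_on_def
  by (auto dest: symD transD)

lemma ConI:
  assumes "\<theta> \<subseteq> carrier N \<times> carrier N"
    and "\<And>x. x \<in> carrier N \<Longrightarrow> (x, x) \<in> \<theta>"
    and "\<And>x y. (x, y) \<in> \<theta> \<Longrightarrow> (y, x) \<in> \<theta>"
    and "\<And>x y z. (x, y) \<in> \<theta> \<Longrightarrow> (y, z) \<in> \<theta> \<Longrightarrow> (x, z) \<in> \<theta>"
    and "\<And>f xs ys. \<tau> f = Some (length xs) \<Longrightarrow> list_all2 (\<lambda>x y. (x, y) \<in> \<theta>) xs ys \<Longrightarrow>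
      (oper N f xs, oper N f ys) \<in> \<theta>"
  shows "\<theta> \<in> Con \<tau> N"
proof -
  have "equiv (carrier N) \<theta>"
    using assms(1-4) unfolding equiv_def refl_on_def sym_def trans_def by blast
  then show ?thesis
    using assms(5) unfolding Con_def by blast
qed

lemma Con_Int: "\<alpha> \<in> Con \<tau> N \<Longrightarrow> \<beta> \<in> Con \<tau> N \<Longrightarrow> \<alpha> \<inter> \<beta> \<in> Con \<tau> N"
proof (rule ConI, goal_cases)
  case (5 f xs ys)
  have "list_all2 (\<lambda>x y. (x, y) \<in> \<alpha>) xs ys" "list_all2 (\<lambda>x y. (x, y) \<in> \<beta>) xs ys"
    using 5(4) by (auto elim: list_all2_mono)
  then show ?case using 5(1-3) by (simp add: Con_compat)
qed (auto dest: Con_sub intro: Con_refl Con_sym Con_trans)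

lemma eval_Con:
  assumes "\<theta> \<in> Con \<tau> N" and "wf_trm \<tau> t" and "\<And>i. i \<in> vars t \<Longrightarrow> (v i, w i) \<in> \<theta>"
  shows "(eval_trm N v t, eval_trm N w t) \<in> \<theta>"
  using assms(2,3)
proof (induction t)
  case (App f ts)
  have "list_all2 (\<lambda>x y. (x, y) \<in> \<theta>) (map (eval_trm N v) ts) (map (eval_trm N w) ts)"
    using App by (auto simp: list_all2_map1 list_all2_map2 list_all_iff intro!: list.rel_refl_strong)
  then show ?case using Con_compat[OF assms(1)] App.prems by simp
qed simp

lemma eval_closed:
  assumes "is_algebra \<tau> N" and "wf_trm \<tau> t" and "range v \<subseteq> carrier N"
  shows "eval_trm N v t \<in> carrier N"
  using assms(2)
proof (induction t)
  case (App f ts)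
  have "set (map (eval_trm N v) ts) \<subseteq> carrier N"
    using App by (auto simp: list_all_iff)
  then show ?case using App.prems assms(1) unfolding is_algebra_def by auto
qed (use assms(3) in auto)

lemma commutator_subset_Int:
  assumes a: "\<alpha> \<in> Con \<tau> N" and b: "\<beta> \<in> Con \<tau> N"
  shows "commutator \<tau> N \<alpha> \<beta> \<subseteq> \<alpha> \<inter> \<beta>"
proof -
  have "centralizes \<tau> N \<alpha> \<beta> (\<alpha> \<inter> \<beta>)"
    unfolding centralizes_def
  proof (intro allI impI, elim conjE)
    fix n k t as bs cs ds
    assume t: "wf_trm \<tau> t" "vars t \<subseteq> {..<n + k}" and len: "length as = n" "length cs = k"
      and ab: "list_all2 (\<lambda>a b. (a, b) \<in> \<alpha>) as bs" and cd: "list_all2 (\<lambda>c d. (c, d) \<in> \<beta>) cs ds"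
    have len': "length bs = n" "length ds = k"
      using ab cd len by (auto dest: list_all2_lengthD)
    have in_c: "set as \<subseteq> carrier N" "set bs \<subseteq> carrier N" "set cs \<subseteq> carrier N" "set ds \<subseteq> carrier N"
      using ab cd Con_sub[OF a] Con_sub[OF b] by (fastforce simp: in_set_conv_nth list_all2_conv_all_nth)+
    have al: "(eval_trm N ((!) (as @ xs)) t, eval_trm N ((!) (bs @ xs)) t) \<in> \<alpha>"
      if "length xs = k" "set xs \<subseteq> carrier N" for xs
      by (rule eval_Con[OF a t(1)])
        (use that t(2) len len' ab Con_refl[OF a] in
          \<open>auto simp: nth_append list_all2_conv_all_nth subset_iff\<close>)
    have be: "(eval_trm N ((!) (xs @ cs)) t, eval_trm N ((!) (xs @ ds)) t) \<in> \<beta>"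
      if "length xs = n" "set xs \<subseteq> carrier N" for xs
      by (rule eval_Con[OF b t(1)])
        (use that t(2) len len' cd Con_refl[OF b] in
          \<open>auto simp: nth_append list_all2_conv_all_nth subset_iff\<close>)
    show "(eval_trm N ((!) (as @ cs)) t, eval_trm N ((!) (as @ ds)) t) \<in> \<alpha> \<inter> \<beta> \<longleftrightarrow>
       (eval_trm N ((!) (bs @ cs)) t, eval_trm N ((!) (bs @ ds)) t) \<in> \<alpha> \<inter> \<beta>"
      using al[OF len(2) in_c(3)] al[OF len'(2) in_c(4)] be[OF len(1) in_c(1)] be[OF len'(1) in_c(2)]
        Con_sym[OF a] Con_trans[OF a] by blast
  qed
  then show ?thesis
    unfolding commutator_def using Con_Int[OF a b] by blast
qed

lemma con_join_le_iff:
  "\<phi> \<in> Con \<tau> N \<Longrightarrow> con_join \<tau> N \<alpha> \<beta> \<subseteq> \<phi> \<longleftrightarrow> \<alpha> \<subseteq> \<phi> \<and> \<beta> \<subseteq> \<phi>"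
  unfolding con_join_def con_Join_def by blast

lemma rad_equiv_iff:
  assumes "\<alpha> \<in> Con \<tau> N" and "\<beta> \<in> Con \<tau> N"
  shows "rad_equiv \<tau> N \<alpha> \<beta> \<longleftrightarrow> (\<forall>\<phi>\<in>Spec \<tau> N. \<alpha> \<subseteq> \<phi> \<longleftrightarrow> \<beta> \<subseteq> \<phi>)"
proof -
  have "radical \<tau> N \<theta> \<subseteq> \<phi> \<longleftrightarrow> \<theta> \<subseteq> \<phi>" if "\<theta> \<in> Con \<tau> N" "\<phi> \<in> Spec \<tau> N" for \<theta> \<phi>
    using that Con_sub[of \<theta> \<tau> N] unfolding radical_def con_top_def by blast
  then show ?thesis
    using assms unfolding rad_equiv_def
    by (metis (mono_tags, lifting) Collect_cong radical_def)
qed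

lemma rad_class_eqI:
  assumes "\<And>\<phi>. \<phi> \<in> Spec \<tau> N \<Longrightarrow> \<alpha> \<subseteq> \<phi> \<longleftrightarrow> \<beta> \<subseteq> \<phi>"
  shows "rad_class \<tau> N \<alpha> = rad_class \<tau> N \<beta>"
proof -
  have "{\<phi> \<in> Spec \<tau> N. \<alpha> \<subseteq> \<phi>} = {\<phi> \<in> Spec \<tau> N. \<beta> \<subseteq> \<phi>}" using assms by blast
  then show ?thesis unfolding rad_class_def rad_equiv_def radical_def by simp
qed

lemma commutator_le_prime_iff:
  assumes "\<alpha> \<in> Con \<tau> N" and "\<beta> \<in> Con \<tau> N" and "\<phi> \<in> Spec \<tau> N"
  shows "commutator \<tau> N \<alpha> \<beta> \<subseteq> \<phi> \<longleftrightarrow> \<alpha> \<subseteq> \<phi> \<or> \<beta> \<subseteq> \<phi>"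
  using assms commutator_subset_Int[OF assms(1,2)] unfolding Spec_def by blast

lemma con_top_in_Con: "is_algebra \<tau> N \<Longrightarrow> con_top N \<in> Con \<tau> N"
proof (rule ConI, goal_cases)
  case (5 f xs ys)
  then have "length ys = length xs" "set xs \<subseteq> carrier N" "set ys \<subseteq> carrier N"
    by (fastforce simp: con_top_def in_set_conv_nth list_all2_conv_all_nth)+
  then show ?case using 5 by (auto simp: con_top_def is_algebra_def)
qed (auto simp: con_top_def)

lemma Inter_in_Con:
  assumes N: "is_algebra \<tau> N" and "S \<subseteq> Con \<tau> N" and "S \<noteq> {}"
  shows "\<Inter> S \<in> Con \<tau> N"
proof (rule ConI, goal_cases)
  case 1 then show ?case using assms Con_sub by fast
next
  case (5 f xs ys)
  have "(oper N f xs, oper N f ys) \<in> \<theta>" if "\<theta> \<in> S" for \<theta>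
  proof -
    have "list_all2 (\<lambda>x y. (x, y) \<in> \<theta>) xs ys" using 5(2) that by (auto elim: list_all2_mono)
    moreover have "\<theta> \<in> Con \<tau> N" using that assms(2) by blast
    ultimately show ?thesis using 5(1) Con_compat[of \<theta> \<tau> N f xs ys] by simp
  qed
  then show ?case by blast
qed (use assms(2) in \<open>auto intro: Con_refl Con_sym Con_trans\<close>)+

lemma Cg_in_Con:
  "is_algebra \<tau> N \<Longrightarrow> X \<subseteq> carrier N \<times> carrier N \<Longrightarrow> Cg \<tau> N X \<in> Con \<tau> N"
  unfolding Cg_def by (rule Inter_in_Con) (use con_top_in_Con in \<open>auto simp: con_top_def\<close>)

lemma con_join_in_Con:
  "is_algebra \<tau> N \<Longrightarrow> \<alpha> \<in> Con \<tau> N \<Longrightarrow> \<beta> \<in> Con \<tau> N \<Longrightarrow> con_join \<tau> N \<alpha> \<beta> \<in> Con \<tau> N"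
  unfolding con_join_def con_Join_def
proof (rule Inter_in_Con, goal_cases)
  case 3
  then have "con_top N \<in> {\<theta> \<in> Con \<tau> N. \<forall>\<gamma>\<in>{\<alpha>, \<beta>}. \<gamma> \<subseteq> \<theta>}"
    using con_top_in_Con[of \<tau> N] Con_sub[of _ \<tau> N] by (simp add: con_top_def)
  then show ?case by blast
qed auto

lemma UN_UN_const:
  assumes "p \<in> P" and "q \<in> Q" and "\<And>x y. x \<in> P \<Longrightarrow> y \<in> Q \<Longrightarrow> h x y = c"
  shows "(\<Union>x\<in>P. \<Union>y\<in>Q. h x y) = c"
  using assms by blast

lemma
  assumes N: "is_algebra \<tau> N" and K: "\<alpha> \<in> KCon \<tau> N" "\<beta> \<in> KCon \<tau> N"
  shows reticulation_ljoin: "ljoin (reticulation \<tau> N) (rad_class \<tau> N \<alpha>) (rad_class \<tau> N \<beta>) =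
      rad_class \<tau> N (con_join \<tau> N \<alpha> \<beta>)"
    and reticulation_lmeet: "lmeet (reticulation \<tau> N) (rad_class \<tau> N \<alpha>) (rad_class \<tau> N \<beta>) =
      rad_class \<tau> N (commutator \<tau> N \<alpha> \<beta>)"
proof -
  have con: "\<gamma> \<in> Con \<tau> N" if "\<gamma> \<in> KCon \<tau> N" for \<gamma>
    using that Cg_in_Con[OF N] unfolding KCon_def by blast
  have self: "\<gamma> \<in> rad_class \<tau> N \<gamma> \<inter> KCon \<tau> N" if "\<gamma> \<in> KCon \<tau> N" for \<gamma>
    using that con unfolding rad_class_def rad_equiv_def by blast
  have same: "\<gamma> \<subseteq> \<phi> \<longleftrightarrow> \<delta> \<subseteq> \<phi>"
    if "\<gamma> \<in> rad_class \<tau> N \<delta> \<inter> KCon \<tau> N" "\<delta> \<in> KCon \<tau> N" "\<phi> \<in> Spec \<tau> N" for \<gamma> \<delta> \<phi>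
    using that con rad_equiv_iff[of \<delta> \<tau> N \<gamma>] unfolding rad_class_def by blast
  have j: "rad_class \<tau> N (con_join \<tau> N \<alpha>' \<beta>') = rad_class \<tau> N (con_join \<tau> N \<alpha> \<beta>)"
    if "\<alpha>' \<in> rad_class \<tau> N \<alpha> \<inter> KCon \<tau> N" "\<beta>' \<in> rad_class \<tau> N \<beta> \<inter> KCon \<tau> N" for \<alpha>' \<beta>'
  proof (rule rad_class_eqI)
    fix \<phi> assume p: "\<phi> \<in> Spec \<tau> N"
    then have "\<phi> \<in> Con \<tau> N" unfolding Spec_def by blast
    then show "con_join \<tau> N \<alpha>' \<beta>' \<subseteq> \<phi> \<longleftrightarrow> con_join \<tau> N \<alpha> \<beta> \<subseteq> \<phi>"
      using same[OF that(1) K(1) p] same[OF that(2) K(2) p] by (simp add: con_join_le_iff)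
  qed
  have m: "rad_class \<tau> N (commutator \<tau> N \<alpha>' \<beta>') = rad_class \<tau> N (commutator \<tau> N \<alpha> \<beta>)"
    if "\<alpha>' \<in> rad_class \<tau> N \<alpha> \<inter> KCon \<tau> N" "\<beta>' \<in> rad_class \<tau> N \<beta> \<inter> KCon \<tau> N" for \<alpha>' \<beta>'
  proof (rule rad_class_eqI)
    fix \<phi> assume p: "\<phi> \<in> Spec \<tau> N"
    show "commutator \<tau> N \<alpha>' \<beta>' \<subseteq> \<phi> \<longleftrightarrow> commutator \<tau> N \<alpha> \<beta> \<subseteq> \<phi>"
      using same[OF that(1) K(1) p] same[OF that(2) K(2) p] that con K p
      by (simp add: commutator_le_prime_iff)
  qed
  show "ljoin (reticulation \<tau> N) (rad_class \<tau> N \<alpha>) (rad_class \<tau> N \<beta>) =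
      rad_class \<tau> N (con_join \<tau> N \<alpha> \<beta>)"
    unfolding reticulation_def blattice.simps
    by (rule UN_UN_const[OF self[OF K(1)] self[OF K(2)]], rule j)
  show "lmeet (reticulation \<tau> N) (rad_class \<tau> N \<alpha>) (rad_class \<tau> N \<beta>) =
      rad_class \<tau> N (commutator \<tau> N \<alpha> \<beta>)"
    unfolding reticulation_def blattice.simps
    by (rule UN_UN_const[OF self[OF K(1)] self[OF K(2)]], rule m)
qed


section \<open>Congruence modularity of a variety does not depend on the carrier type\<close>

lemma trancl_oper:
  assumes N: "is_algebra \<tau> N" and R: "R \<subseteq> carrier N \<times> carrier N"
    and refl: "\<And>x. x \<in> carrier N \<Longrightarrow> (x, x) \<in> R\<^sup>+"
    and step: "\<And>f pre x y post. \<tau> f = Some (length pre + Suc (length post)) \<Longrightarrow>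
      set pre \<subseteq> carrier N \<Longrightarrow> set post \<subseteq> carrier N \<Longrightarrow> (x, y) \<in> R \<Longrightarrow>
      (oper N f (pre @ x # post), oper N f (pre @ y # post)) \<in> R"
    and "list_all2 (\<lambda>x y. (x, y) \<in> R\<^sup>+) xs ys" and "set pre \<subseteq> carrier N"
    and "\<tau> f = Some (length pre + length xs)"
  shows "(oper N f (pre @ xs), oper N f (pre @ ys)) \<in> R\<^sup>+"
  using assms(5-)
proof (induction arbitrary: pre rule: list_all2_induct)
  case Nil
  then show ?case using N refl unfolding is_algebra_def by auto
next
  case (Cons x xs y ys)
  have R': "R\<^sup>+ \<subseteq> carrier N \<times> carrier N" using R by (rule trancl_subset_Sigma)
  have xs: "set xs \<subseteq> carrier N"
    using Cons(2) R' by (fastforce simp: in_set_conv_nth list_all2_conv_all_nth)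
  have y: "y \<in> carrier N" using Cons(1) R' by blast
  have "(oper N f (pre @ x # xs), oper N f (pre @ y # xs)) \<in> R\<^sup>+"
    using Cons(1)
  proof (induction rule: trancl_induct)
    case (base z)
    then show ?case using step[of f pre xs x z] Cons(4,5) xs by auto
  next
    case (step z w)
    have "(oper N f (pre @ z # xs), oper N f (pre @ w # xs)) \<in> R"
      using assms(4)[of f pre xs z w] Cons(4,5) xs step(2) by auto
    then show ?case using step(3) by (rule trancl_into_trancl[rotated])
  qed
  moreover have "(oper N f ((pre @ [y]) @ xs), oper N f ((pre @ [y]) @ ys)) \<in> R\<^sup>+"
    using Cons(3)[of "pre @ [y]"] Cons(4,5) y by auto
  ultimately show ?case by (auto intro: trancl_trans)
qed

lemma con_join_eq_trancl:
  assumes N: "is_algebra \<tau> N" and a: "\<alpha> \<in> Con \<tau> N" and b: "\<beta> \<in> Con \<tau> N"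
  shows "con_join \<tau> N \<alpha> \<beta> = (\<alpha> \<union> \<beta>)\<^sup>+"
proof
  have sub: "\<alpha> \<union> \<beta> \<subseteq> carrier N \<times> carrier N" using Con_sub[OF a] Con_sub[OF b] by blast
  have refl: "(x, x) \<in> (\<alpha> \<union> \<beta>)\<^sup>+" if "x \<in> carrier N" for x using Con_refl[OF a that] by auto
  have comp1: "(oper N f (pre @ x # post), oper N f (pre @ y # post)) \<in> \<theta>"
    if "\<theta> \<in> Con \<tau> N" "\<tau> f = Some (length pre + Suc (length post))"
      "set pre \<subseteq> carrier N" "set post \<subseteq> carrier N" "(x, y) \<in> \<theta>" for \<theta> f pre x y post
    by (rule Con_compat[OF that(1)])
      (use that Con_refl[OF that(1)] in
        \<open>auto intro!: list_all2_appendI list.rel_refl_strong\<close>)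
  have "(\<alpha> \<union> \<beta>)\<^sup>+ \<in> Con \<tau> N"
  proof (rule ConI, goal_cases)
    case 1 then show ?case using sub by (rule trancl_subset_Sigma)
  next
    case (2 x) then show ?case by (rule refl)
  next
    case (3 x y)
    have "sym (\<alpha> \<union> \<beta>)" using Con_sym[OF a] Con_sym[OF b] by (auto intro: symI)
    then show ?case using 3 by (meson sym_trancl symD)
  next
    case 4 then show ?case by (rule trancl_trans)
  next
    case (5 f xs ys)
    have "(oper N f ([] @ xs), oper N f ([] @ ys)) \<in> (\<alpha> \<union> \<beta>)\<^sup>+"
      by (rule trancl_oper[OF N sub refl _ 5(2)]) (use 5(1) comp1 a b in auto)
    then show ?case by simp
  qed
  then show "con_join \<tau> N \<alpha> \<beta> \<subseteq> (\<alpha> \<union> \<beta>)\<^sup>+"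
    unfolding con_join_def con_Join_def by auto
  have "(\<alpha> \<union> \<beta>)\<^sup>+ \<subseteq> \<theta>" if "\<theta> \<in> Con \<tau> N" "\<alpha> \<subseteq> \<theta>" "\<beta> \<subseteq> \<theta>" for \<theta>
  proof -
    have "trans \<theta>" using Con_trans[OF that(1)] by (auto intro: transI)
    then have "\<theta>\<^sup>+ = \<theta>" by (rule trancl_id)
    then show ?thesis using trancl_mono_subset[of "\<alpha> \<union> \<beta>" \<theta>] that(2,3) by blast
  qed
  then show "(\<alpha> \<union> \<beta>)\<^sup>+ \<subseteq> con_join \<tau> N \<alpha> \<beta>"
    unfolding con_join_def con_Join_def by blast
qed

lemma trancl_finite_support:
  assumes "(a, b) \<in> R\<^sup>+" and "R \<subseteq> C \<times> C"
  shows "\<exists>F. finite F \<and> F \<subseteq> C \<and> a \<in> F \<and> b \<in> F \<and> (a, b) \<in> (R \<inter> F \<times> F)\<^sup>+"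
  using assms(1)
proof (induction rule: trancl_induct)
  case (base y)
  then show ?case using assms(2) by (intro exI[of _ "{a, y}"]) auto
next
  case (step y z)
  then obtain F where F: "finite F" "F \<subseteq> C" "a \<in> F" "y \<in> F" "(a, y) \<in> (R \<inter> F \<times> F)\<^sup>+" by blast
  let ?G = "insert z F"
  have "(a, y) \<in> (R \<inter> ?G \<times> ?G)\<^sup>+" using F(5) by (rule trancl_mono) blast
  moreover have "(y, z) \<in> R \<inter> ?G \<times> ?G" using step(2) F(4) by blast
  ultimately have "(a, z) \<in> (R \<inter> ?G \<times> ?G)\<^sup>+" by (rule trancl_into_trancl)
  then show ?case using F step(2) assms(2) by (intro exI[of _ ?G]) blast
qed

text \<open>
  If the modular law fails in \<open>N\<close>, it fails in a finitely generated subalgebra, and a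
  copy of that subalgebra lives on a set of terms.
\<close>

theorem congruence_modular_imp_con_modular:
  fixes \<tau> :: "'f \<rightharpoonup> nat" and N :: "('f, 'a) algebra"
  assumes E: "is_identities \<tau> E" and cm: "congruence_modular \<tau> E" and NV: "N \<in> variety \<tau> E"
  shows "con_modular \<tau> N"
  unfolding con_modular_def
proof (intro ballI impI equalityI subsetI)
  fix \<alpha> \<beta> \<gamma>
  assume a: "\<alpha> \<in> Con \<tau> N" and b: "\<beta> \<in> Con \<tau> N" and c: "\<gamma> \<in> Con \<tau> N" and ac: "\<alpha> \<subseteq> \<gamma>"
  have N: "is_algebra \<tau> N" using NV unfolding variety_def by blast
  note bc = Con_Int[OF b c]
  fix p
  {
    assume "p \<in> con_join \<tau> N \<alpha> (\<beta> \<inter> \<gamma>)"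
    moreover have "con_join \<tau> N \<alpha> (\<beta> \<inter> \<gamma>) \<subseteq> con_join \<tau> N \<alpha> \<beta>"
      unfolding con_join_def con_Join_def by blast
    moreover have "con_join \<tau> N \<alpha> (\<beta> \<inter> \<gamma>) \<subseteq> \<gamma>"
      using c ac by (simp add: con_join_le_iff)
    ultimately show "p \<in> con_join \<tau> N \<alpha> \<beta> \<inter> \<gamma>" by blast
  }
  assume p: "p \<in> con_join \<tau> N \<alpha> \<beta> \<inter> \<gamma>"
  obtain x y where xy: "p = (x, y)" by fastforce
  have "(x, y) \<in> (\<alpha> \<union> \<beta>)\<^sup>+" using p xy con_join_eq_trancl[OF N a b] by blast
  moreover have "\<alpha> \<union> \<beta> \<subseteq> carrier N \<times> carrier N" using Con_sub[OF a] Con_sub[OF b] by blast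
  ultimately obtain F where F: "finite F" "F \<subseteq> carrier N" "x \<in> F" "y \<in> F"
      "(x, y) \<in> ((\<alpha> \<union> \<beta>) \<inter> F \<times> F)\<^sup>+"
    using trancl_finite_support by metis
  obtain v :: "nat \<Rightarrow> 'a" where v: "range v = F"
  proof -
    obtain n and h :: "nat \<Rightarrow> 'a" where h: "F = h ` {i. i < n}"
      using finite_imp_nat_seg_image_inj_on[OF F(1)] by metis
    have "range (\<lambda>i. if i < n then h i else x) = F"
      using F(3) h by auto
    then show thesis by (rule that)
  qed
  define e where "e = eval_trm N v"
  define S where "S = e ` {t. wf_trm \<tau> t}"
  define g where "g s = (SOME t. wf_trm \<tau> t \<and> e t = s)" for s
  define T where "T = \<lparr>carrier = g ` S, oper = (\<lambda>f ts. g (oper N f (map e ts)))\<rparr>"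
  have g: "wf_trm \<tau> (g s)" "e (g s) = s" if "s \<in> S" for s
    using someI_ex[of "\<lambda>t. wf_trm \<tau> t \<and> e t = s"] that unfolding S_def g_def by auto
  have eT: "e u \<in> S" "g (e u) = u" if "u \<in> carrier T" for u
    using that g(2) unfolding T_def by auto
  have gT: "g s \<in> carrier T" if "s \<in> S" for s using that unfolding T_def by simp
  have SN: "S \<subseteq> carrier N"
    unfolding S_def e_def using eval_closed[OF N, of _ v] v F(2) by auto
  have FS: "F \<subseteq> S"
  proof
    fix z assume "z \<in> F"
    then obtain i where "z = v i" using v by blast
    then have "z = e (Var i)" by (simp add: e_def)
    then show "z \<in> S" unfolding S_def by (auto intro: rev_image_eqI)
  qed
  have S_oper: "oper N f xs \<in> S" if "\<tau> f = Some (length xs)" "set xs \<subseteq> S" for f xs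
  proof -
    have "map (e \<circ> g) xs = xs" using that(2) g(2) by (intro map_idI) auto
    then have "oper N f xs = e (App f (map g xs))"
      by (simp add: e_def comp_def)
    moreover have "wf_trm \<tau> (App f (map g xs))"
      using that g(1) by (auto simp: list_all_iff)
    ultimately show ?thesis unfolding S_def by blast
  qed
  have T_oper: "oper T f ts \<in> carrier T" "e (oper T f ts) = oper N f (map e ts)"
    if "\<tau> f = Some (length ts)" "set ts \<subseteq> carrier T" for f ts
  proof -
    have "oper N f (map e ts) \<in> S" by (rule S_oper) (use that eT in auto)
    then show "oper T f ts \<in> carrier T" "e (oper T f ts) = oper N f (map e ts)"
      using g(2) by (auto simp: T_def)
  qed
  have T: "is_algebra \<tau> T"
    unfolding is_algebra_def using F(3) FS gT T_oper(1) by blast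
  have eval_T: "e (eval_trm T w t) = eval_trm N (e \<circ> w) t"
    if "range w \<subseteq> carrier T" "wf_trm \<tau> t" for w t
    using that(2)
  proof (induction t)
    case (App f ts)
    have "set (map (eval_trm T w) ts) \<subseteq> carrier T"
      using App.prems eval_closed[OF T _ that(1)] by (auto simp: list_all_iff)
    then have "e (eval_trm T w (App f ts)) = oper N f (map e (map (eval_trm T w) ts))"
      using T_oper(2)[of f "map (eval_trm T w) ts"] App.prems by simp
    also have "map e (map (eval_trm T w) ts) = map (eval_trm N (e \<circ> w)) ts"
      using App by (auto simp: list_all_iff comp_def)
    finally show ?case by (simp add: comp_def)
  qed simp
  have TV: "T \<in> variety \<tau> E"
    unfolding variety_def
  proof (clarify, intro conjI T, clarify)
    fix s t and w :: "nat \<Rightarrow> 'f trm"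
    assume st: "(s, t) \<in> E" and w: "range w \<subseteq> carrier T"
    have wf: "wf_trm \<tau> s" "wf_trm \<tau> t" using E st unfolding is_identities_def by auto
    have "range (e \<circ> w) \<subseteq> carrier N" using w eT(1) SN by auto
    then have "eval_trm N (e \<circ> w) s = eval_trm N (e \<circ> w) t"
      using NV st unfolding variety_def by blast
    then have "e (eval_trm T w s) = e (eval_trm T w t)" using eval_T[OF w] wf by simp
    then show "eval_trm T w s = eval_trm T w t"
      using eT(2) eval_closed[OF T _ w] wf by metis
  qed
  define pb where "pb \<theta> = {(u, w). u \<in> carrier T \<and> w \<in> carrier T \<and> (e u, e w) \<in> \<theta>}" for \<theta>
  have pb_Con: "pb \<theta> \<in> Con \<tau> T" if th: "\<theta> \<in> Con \<tau> N" for \<theta>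
  proof (rule ConI, goal_cases)
    case (2 u) then show ?case using eT(1) SN Con_refl[OF th] unfolding pb_def by blast
  next
    case (3 u w) then show ?case using Con_sym[OF th] unfolding pb_def by blast
  next
    case (4 u w z) then show ?case using Con_trans[OF th, of "e u" "e w" "e z"] unfolding pb_def by blast
  next
    case (5 f us ws)
    have us: "set us \<subseteq> carrier T" "set ws \<subseteq> carrier T" "length ws = length us"
      using 5(2) by (fastforce simp: pb_def in_set_conv_nth list_all2_conv_all_nth)+
    have "list_all2 (\<lambda>x y. (x, y) \<in> \<theta>) (map e us) (map e ws)"
      using 5(2) by (auto simp: list_all2_conv_all_nth pb_def)
    then have "(oper N f (map e us), oper N f (map e ws)) \<in> \<theta>"
      using 5(1) by (intro Con_compat[OF th]) auto
    then show ?case using T_oper[of f us] T_oper[of f ws] us 5(1) unfolding pb_def by simp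
  qed (auto simp: pb_def)
  have pb_F: "(g z, g z') \<in> pb \<theta>" if "z \<in> F" "z' \<in> F" "(z, z') \<in> \<theta>" for z z' \<theta>
  proof -
    have "z \<in> S" "z' \<in> S" using that FS by blast+
    then show ?thesis unfolding pb_def by (simp add: gT g(2) that(3))
  qed
  have "(g x, g z) \<in> (pb \<alpha> \<union> pb \<beta>)\<^sup>+" if "(x, z) \<in> ((\<alpha> \<union> \<beta>) \<inter> F \<times> F)\<^sup>+" for z
    using that
  proof (induction rule: trancl_induct)
    case (base z)
    then have "(g x, g z) \<in> pb \<alpha> \<union> pb \<beta>" using pb_F by blast
    then show ?case by blast
  next
    case (step z z')
    then have "(g z, g z') \<in> pb \<alpha> \<union> pb \<beta>" using pb_F by blast
    then show ?case using step(3) by (rule trancl_into_trancl[rotated])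
  qed
  then have "(g x, g y) \<in> con_join \<tau> T (pb \<alpha>) (pb \<beta>)"
    using F(5) con_join_eq_trancl[OF T pb_Con[OF a] pb_Con[OF b]] by simp
  moreover have "(g x, g y) \<in> pb \<gamma>"
    using p xy F(3,4) by (intro pb_F) auto
  moreover have "con_modular \<tau> T" using cm TV unfolding congruence_modular_def by blast
  moreover have "pb \<alpha> \<subseteq> pb \<gamma>" using ac unfolding pb_def by blast
  ultimately have "(g x, g y) \<in> con_join \<tau> T (pb \<alpha>) (pb \<beta> \<inter> pb \<gamma>)"
    using pb_Con a b c unfolding con_modular_def by blast
  moreover have "con_join \<tau> T (pb \<alpha>) (pb \<beta> \<inter> pb \<gamma>) \<subseteq> pb (con_join \<tau> N \<alpha> (\<beta> \<inter> \<gamma>))"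
  proof -
    let ?J = "con_join \<tau> N \<alpha> (\<beta> \<inter> \<gamma>)"
    have J: "?J \<in> Con \<tau> N" by (rule con_join_in_Con[OF N a bc])
    have "\<alpha> \<subseteq> ?J" "\<beta> \<inter> \<gamma> \<subseteq> ?J"
      using iffD1[OF con_join_le_iff[OF J] subset_refl] by simp_all
    then have "pb \<alpha> \<subseteq> pb ?J" "pb \<beta> \<inter> pb \<gamma> \<subseteq> pb ?J"
      unfolding pb_def by (auto simp: subset_iff)
    then show ?thesis by (simp add: con_join_le_iff[OF pb_Con[OF J]])
  qed
  ultimately have "(e (g x), e (g y)) \<in> con_join \<tau> N \<alpha> (\<beta> \<inter> \<gamma>)"
    unfolding pb_def by auto
  then show "p \<in> con_join \<tau> N \<alpha> (\<beta> \<inter> \<gamma>)"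
    using xy F(3,4) FS g(2)[of x] g(2)[of y] by (simp add: subset_iff)
qed

end

theory Submission
  imports Defs
begin

text \<open>
  Terms are evaluated coordinatewise in \<open>A \<times> M\<close>. Filling up one coordinate with a constant
  element shows that \<open>\<alpha> \<times> \<mu>\<close> centralizes \<open>\<beta> \<times> \<nu>\<close> modulo \<open>\<gamma> \<times> \<delta>\<close> iff this holds in both
  coordinates. In the absence of skew congruences the commutator of \<open>A \<times> M\<close> is therefore
  computed coordinatewise. Since \<open>[\<nabla> \<times> \<Delta>, \<Delta> \<times> \<nabla>] = \<Delta> \<times> \<Delta>\<close>,
  one coordinate of a prime congruence of \<open>A \<times> M\<close> is \<open>\<nabla>\<close>, and the other one is then prime.
  So radicals are computed coordinatewise as well.
\<close>

section \<open>Products of binary relations\<close>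

lemma mem_rel_times [simp]: "((a, u), (b, v)) \<in> X \<otimes>\<^sub>r Y \<longleftrightarrow> (a, b) \<in> X \<and> (u, v) \<in> Y"
  unfolding rel_times_def by blast

lemma mem_rel_times_iff:
  "(p, q) \<in> X \<otimes>\<^sub>r Y \<longleftrightarrow> (fst p, fst q) \<in> X \<and> (snd p, snd q) \<in> Y"
  by (cases p; cases q) simp

lemma rel_times_Int: "(X \<otimes>\<^sub>r Y) \<inter> (X' \<otimes>\<^sub>r Y') = (X \<inter> X') \<otimes>\<^sub>r (Y \<inter> Y')"
  by (auto simp: mem_rel_times_iff)

lemma rel_times_mono: "X \<subseteq> X' \<Longrightarrow> Y \<subseteq> Y' \<Longrightarrow> X \<otimes>\<^sub>r Y \<subseteq> X' \<otimes>\<^sub>r Y'"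
  by (auto simp: mem_rel_times_iff)

text \<open>A fixed pair of one factor completes every pair of the other to a member of the product,
  so inclusions can be read off coordinatewise. A product with an empty factor is empty and retains
  nothing of the other factor.\<close>

lemma rel_times_subset_iff:
  assumes "X \<noteq> {}" and "Y \<noteq> {}"
  shows "X \<otimes>\<^sub>r Y \<subseteq> X' \<otimes>\<^sub>r Y' \<longleftrightarrow> X \<subseteq> X' \<and> Y \<subseteq> Y'"
proof
  assume sub: "X \<otimes>\<^sub>r Y \<subseteq> X' \<otimes>\<^sub>r Y'"
  obtain x x' y y' where xy: "(x, x') \<in> X" "(y, y') \<in> Y" using assms by fast
  show "X \<subseteq> X' \<and> Y \<subseteq> Y'"
  proof (intro conjI subrelI)
    fix a b assume "(a, b) \<in> X"
    then have "((a, y), (b, y')) \<in> X \<otimes>\<^sub>r Y" using xy by simp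
    with sub have "((a, y), (b, y')) \<in> X' \<otimes>\<^sub>r Y'" by (rule subsetD)
    then show "(a, b) \<in> X'" by simp
  next
    fix u v assume "(u, v) \<in> Y"
    then have "((x, u), (x', v)) \<in> X \<otimes>\<^sub>r Y" using xy by simp
    with sub have "((x, u), (x', v)) \<in> X' \<otimes>\<^sub>r Y'" by (rule subsetD)
    then show "(u, v) \<in> Y'" by simp
  qed
qed (simp add: rel_times_mono)

lemma finite_rel_times:
  assumes "finite X" and "finite Y"
  shows "finite (X \<otimes>\<^sub>r Y)"
proof -
  \<comment> \<open>\<open>?f\<close> regroups two pairs by coordinates; the product relation is the
    preimage of the finite set \<open>X \<times> Y\<close> under this injection.\<close>
  let ?f = "\<lambda>(p, q). ((fst p, fst q), (snd p, snd q))"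
  have "inj ?f" by (rule injI) auto
  then have "finite (?f -` (X \<times> Y))" by (intro finite_vimageI finite_cartesian_product assms)
  also have "?f -` (X \<times> Y) = X \<otimes>\<^sub>r Y" by (auto simp: mem_rel_times_iff)
  finally show ?thesis .
qed

section \<open>The product algebra and the evaluation of terms in it\<close>

lemma carrier_prod_algebra [simp]: "carrier (prod_algebra A M) = carrier A \<times> carrier M"
  by (simp add: prod_algebra_def)

lemma oper_prod_algebra [simp]:
  "oper (prod_algebra A M) f xs = (oper A f (map fst xs), oper M f (map snd xs))"
  by (simp add: prod_algebra_def)

lemma eval_trm_prod_algebra:
  "eval_trm (prod_algebra A M) w t = (eval_trm A (\<lambda>i. fst (w i)) t, eval_trm M (\<lambda>i. snd (w i)) t)"
proof (induction t)
  case (App f ts)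
  have "map fst (map (eval_trm (prod_algebra A M) w) ts) = map (eval_trm A (\<lambda>i. fst (w i))) ts"
    "map snd (map (eval_trm (prod_algebra A M) w) ts) = map (eval_trm M (\<lambda>i. snd (w i))) ts"
    by (simp_all add: App.IH)
  then show ?case by (simp only: eval_trm.simps oper_prod_algebra)
qed simp

lemma eval_trm_cong:
  "(\<And>i. i \<in> vars t \<Longrightarrow> v i = w i) \<Longrightarrow> eval_trm N v t = eval_trm N w t"
proof (induction t)
  case (App f ts)
  then have "map (eval_trm N v) ts = map (eval_trm N w) ts" by auto
  then show ?case by (simp only: eval_trm.simps)
qed simp

text \<open>\<open>map\<close> commutes with \<open>(!)\<close> at valid indices; the bound on the
  variables ensures that no other index is read.\<close>

lemma eval_trm_prod_algebra_nth:
  assumes "vars t \<subseteq> {..<length xs}"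
  shows "eval_trm (prod_algebra A M) ((!) xs) t =
    (eval_trm A ((!) (map fst xs)) t, eval_trm M ((!) (map snd xs)) t)"
  unfolding eval_trm_prod_algebra
  by (intro arg_cong2[where f = Pair] eval_trm_cong) (use assms in auto)

lemma is_algebra_prod:
  assumes A: "is_algebra \<tau> A" and M: "is_algebra \<tau> M"
  shows "is_algebra \<tau> (prod_algebra A M)"
  unfolding is_algebra_def
proof (intro conjI allI impI, goal_cases)
  case 1
  then show ?case using A M by (simp add: is_algebra_def)
next
  case (2 f xs)
  then have "set (map fst xs) \<subseteq> carrier A" "set (map snd xs) \<subseteq> carrier M" by auto
  then show ?case
    using 2 A[unfolded is_algebra_def] M[unfolded is_algebra_def] by simp
qed

lemma con_top_prod: "con_top (prod_algebra A M) = con_top A \<otimes>\<^sub>r con_top M"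
  unfolding con_top_def rel_times_def by auto

lemma con_bot_prod: "con_bot (prod_algebra A M) = con_bot A \<otimes>\<^sub>r con_bot M"
  unfolding con_bot_def rel_times_def by auto

section \<open>Least, greatest and generated congruences, and joins\<close>

lemma Con_nonempty: "is_algebra \<tau> N \<Longrightarrow> \<theta> \<in> Con \<tau> N \<Longrightarrow> \<theta> \<noteq> {}"
  unfolding is_algebra_def using Con_refl[of \<theta> \<tau> N] by blast

lemma Con_subset_con_top: "\<theta> \<in> Con \<tau> N \<Longrightarrow> \<theta> \<subseteq> con_top N"
  unfolding con_top_def by (rule Con_sub)

lemma con_bot_subset_Con: "\<theta> \<in> Con \<tau> N \<Longrightarrow> con_bot N \<subseteq> \<theta>"
  unfolding con_bot_def using Con_refl[of \<theta> \<tau> N] by auto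

lemma con_bot_in_Con:
  assumes "is_algebra \<tau> N"
  shows "con_bot N \<in> Con \<tau> N"
proof (rule ConI, goal_cases)
  case (5 f xs ys)
  then have "list_all2 (\<lambda>x y. x \<in> carrier N \<and> x = y) xs ys"
    by (auto simp: con_bot_def elim!: list_all2_mono)
  \<comment> \<open>Lists related entrywise by the diagonal coincide, so compatibility reduces to
    closure of the carrier under the operations.\<close>
  then have "ys = xs" "set xs \<subseteq> carrier N"
    by (induction rule: list_all2_induct) auto
  then show ?case using 5(1) assms by (auto simp: con_bot_def is_algebra_def)
qed (auto simp: con_bot_def)

lemma Cg_least: "\<theta> \<in> Con \<tau> N \<Longrightarrow> X \<subseteq> \<theta> \<Longrightarrow> Cg \<tau> N X \<subseteq> \<theta>"
  unfolding Cg_def by blast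

lemma subset_Cg: "X \<subseteq> Cg \<tau> N X"
  unfolding Cg_def by blast

lemma Cg_eqI:
  assumes "\<theta> \<in> Con \<tau> N" and "X \<subseteq> \<theta>" and "\<And>\<phi>. \<phi> \<in> Con \<tau> N \<Longrightarrow> X \<subseteq> \<phi> \<Longrightarrow> \<theta> \<subseteq> \<phi>"
  shows "Cg \<tau> N X = \<theta>"
  unfolding Cg_def
  by (intro equalityI Inter_lower Inter_greatest) (use assms in simp_all)

lemma Cg_insert_refl: "a \<in> carrier N \<Longrightarrow> Cg \<tau> N (insert (a, a) X) = Cg \<tau> N X"
  unfolding Cg_def by (intro arg_cong[where f = Inter]) (auto dest: Con_refl)

lemma KConI: "finite X \<Longrightarrow> X \<subseteq> carrier N \<times> carrier N \<Longrightarrow> Cg \<tau> N X \<in> KCon \<tau> N"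
  unfolding KCon_def by blast

lemma KCon_in_Con: "is_algebra \<tau> N \<Longrightarrow> \<alpha> \<in> KCon \<tau> N \<Longrightarrow> \<alpha> \<in> Con \<tau> N"
  unfolding KCon_def using Cg_in_Con by blast

text \<open>Generators for a product will be formed as a product of generating sets, where an empty
  set would annihilate the other factor. A reflexive pair lies in every congruence, so adding one
  makes the set nonempty and generates nothing new.\<close>

lemma KCon_nonempty_generators:
  assumes N: "is_algebra \<tau> N" and "\<alpha> \<in> KCon \<tau> N"
  obtains X where "finite X" "X \<noteq> {}" "X \<subseteq> carrier N \<times> carrier N" "\<alpha> = Cg \<tau> N X"
proof -
  obtain X where X: "finite X" "X \<subseteq> carrier N \<times> carrier N" "\<alpha> = Cg \<tau> N X"
    using assms(2) unfolding KCon_def by blast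
  obtain a where a: "a \<in> carrier N" using N unfolding is_algebra_def by blast
  show thesis by (rule that[of "insert (a, a) X"]) (use X a in \<open>simp_all add: Cg_insert_refl\<close>)
qed

lemma con_join_eqI:
  assumes "\<theta> \<in> Con \<tau> N" and "\<alpha> \<subseteq> \<theta>" and "\<beta> \<subseteq> \<theta>"
    and "\<And>\<phi>. \<phi> \<in> Con \<tau> N \<Longrightarrow> \<alpha> \<subseteq> \<phi> \<Longrightarrow> \<beta> \<subseteq> \<phi> \<Longrightarrow> \<theta> \<subseteq> \<phi>"
  shows "con_join \<tau> N \<alpha> \<beta> = \<theta>"
  unfolding con_join_def con_Join_def
  by (intro equalityI Inter_lower Inter_greatest) (use assms in simp_all)

lemma con_join_upper: "\<alpha> \<subseteq> con_join \<tau> N \<alpha> \<beta>" "\<beta> \<subseteq> con_join \<tau> N \<alpha> \<beta>"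
  unfolding con_join_def con_Join_def by (intro Inter_greatest; simp)+

section \<open>The term condition, commutators and radicals in a single algebra\<close>

lemma centralizes_Inter:
  assumes "\<And>\<mu>. \<mu> \<in> S \<Longrightarrow> centralizes \<tau> N \<alpha> \<beta> \<mu>"
  shows "centralizes \<tau> N \<alpha> \<beta> (\<Inter> S)"
  unfolding centralizes_def
proof (intro allI impI, goal_cases)
  case (1 n k t as bs cs ds)
  have "(eval_trm N ((!) (as @ cs)) t, eval_trm N ((!) (as @ ds)) t) \<in> \<mu> \<longleftrightarrow>
      (eval_trm N ((!) (bs @ cs)) t, eval_trm N ((!) (bs @ ds)) t) \<in> \<mu>" if "\<mu> \<in> S" for \<mu>
    by (rule assms[OF that, unfolded centralizes_def, rule_format, OF 1])
  then show ?case by simp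
qed

text \<open>
  The set in the definition of the commutator is nonempty: otherwise the commutator, being
  below \<open>\<alpha> \<inter> \<beta>\<close>, would be \<open>UNIV = con_top N\<close>, which satisfies every term condition.
\<close>

lemma centralizing_nonempty:
  assumes N: "is_algebra \<tau> N" and ab: "\<alpha> \<in> Con \<tau> N" "\<beta> \<in> Con \<tau> N"
  shows "{\<mu> \<in> Con \<tau> N. centralizes \<tau> N \<alpha> \<beta> \<mu>} \<noteq> {}"
proof
  assume empty: "{\<mu> \<in> Con \<tau> N. centralizes \<tau> N \<alpha> \<beta> \<mu>} = {}"
  then have "UNIV \<subseteq> con_top N"
    using commutator_subset_Int[OF ab] Con_subset_con_top[OF ab(1)]
    unfolding commutator_def by auto
  then have "con_top N = UNIV" by blast
  then have "centralizes \<tau> N \<alpha> \<beta> (con_top N)" unfolding centralizes_def by simp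
  then show False using con_top_in_Con[OF N] empty by blast
qed

lemma commutator_in_Con:
  "is_algebra \<tau> N \<Longrightarrow> \<alpha> \<in> Con \<tau> N \<Longrightarrow> \<beta> \<in> Con \<tau> N \<Longrightarrow> commutator \<tau> N \<alpha> \<beta> \<in> Con \<tau> N"
  unfolding commutator_def by (rule Inter_in_Con) (use centralizing_nonempty in auto)

text \<open>The term condition is an equivalence between memberships and hence survives
  intersections. So the intersection defining the commutator again satisfies it.\<close>

lemma centralizes_commutator: "centralizes \<tau> N \<alpha> \<beta> (commutator \<tau> N \<alpha> \<beta>)"
  unfolding commutator_def by (rule centralizes_Inter) blast

lemma commutator_eqI:
  assumes "\<theta> \<in> Con \<tau> N" and "centralizes \<tau> N \<alpha> \<beta> \<theta>"
    and "\<And>\<mu>. \<mu> \<in> Con \<tau> N \<Longrightarrow> centralizes \<tau> N \<alpha> \<beta> \<mu> \<Longrightarrow> \<theta> \<subseteq> \<mu>"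
  shows "commutator \<tau> N \<alpha> \<beta> = \<theta>"
  unfolding commutator_def
  by (intro equalityI Inter_lower Inter_greatest) (use assms in simp_all)

lemma commutator_least:
  "\<mu> \<in> Con \<tau> N \<Longrightarrow> centralizes \<tau> N \<alpha> \<beta> \<mu> \<Longrightarrow> commutator \<tau> N \<alpha> \<beta> \<subseteq> \<mu>"
  unfolding commutator_def by (simp add: Inter_lower)

lemma radical_in_Con: "is_algebra \<tau> N \<Longrightarrow> radical \<tau> N \<theta> \<in> Con \<tau> N"
proof -
  assume N: "is_algebra \<tau> N"
  \<comment> \<open>Adding \<open>con_top N\<close> to the family keeps it nonempty, as
    \<open>Inter_in_Con\<close> requires, even if no prime lies above \<theta>.\<close>
  have "radical \<tau> N \<theta> = \<Inter> (insert (con_top N) {\<phi> \<in> Spec \<tau> N. \<theta> \<subseteq> \<phi>})"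
    unfolding radical_def by simp
  also have "\<dots> \<in> Con \<tau> N"
    by (rule Inter_in_Con[OF N]) (use con_top_in_Con[OF N] in \<open>auto simp: Spec_def\<close>)
  finally show ?thesis .
qed

lemma rad_class_eq_iff:
  assumes "\<beta> \<in> Con \<tau> N"
  shows "rad_class \<tau> N \<alpha> = rad_class \<tau> N \<beta> \<longleftrightarrow> rad_equiv \<tau> N \<alpha> \<beta>"
  using assms unfolding rad_class_def rad_equiv_def by auto

section \<open>Products of congruences and of term conditions\<close>

lemma Con_rel_times:
  assumes a: "\<alpha> \<in> Con \<tau> A" and m: "\<mu> \<in> Con \<tau> M"
  shows "\<alpha> \<otimes>\<^sub>r \<mu> \<in> Con \<tau> (prod_algebra A M)"
proof (rule ConI, goal_cases)
  case 1
  show ?case using Con_sub[OF a] Con_sub[OF m] unfolding rel_times_def by auto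
next
  case (5 f xs ys)
  then have "list_all2 (\<lambda>x y. (x, y) \<in> \<alpha>) (map fst xs) (map fst ys)"
    "list_all2 (\<lambda>x y. (x, y) \<in> \<mu>) (map snd xs) (map snd ys)"
    by (auto simp: list_all2_conv_all_nth mem_rel_times_iff)
  then show ?case using 5(1) Con_compat[OF a, of f] Con_compat[OF m, of f] by simp
next
  case (4 p q r)
  then show ?case
    unfolding mem_rel_times_iff by (blast intro: Con_trans[OF a] Con_trans[OF m])
qed (auto simp: mem_rel_times_iff Con_refl[OF a] Con_refl[OF m]
  intro: Con_sym[OF a] Con_sym[OF m])

text \<open>Evaluation and membership both split by coordinates, so the equivalence for the product
  follows from the two coordinate equivalences, joined by conjunction on each side.\<close>

lemma centralizes_rel_times:
  assumes c: "centralizes \<tau> A \<alpha> \<beta> \<gamma>" and d: "centralizes \<tau> M \<mu> \<nu> \<delta>"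
  shows "centralizes \<tau> (prod_algebra A M) (\<alpha> \<otimes>\<^sub>r \<mu>) (\<beta> \<otimes>\<^sub>r \<nu>) (\<gamma> \<otimes>\<^sub>r \<delta>)"
  unfolding centralizes_def
proof (intro allI impI, elim conjE)
  fix n k t as bs cs ds
  assume t: "wf_trm \<tau> t" "vars t \<subseteq> {..<n + k}" and len: "length as = n" "length cs = k"
    and ab: "list_all2 (\<lambda>a b. (a, b) \<in> \<alpha> \<otimes>\<^sub>r \<mu>) as bs"
    and cd: "list_all2 (\<lambda>c d. (c, d) \<in> \<beta> \<otimes>\<^sub>r \<nu>) cs ds"
  have len': "length bs = n" "length ds = k"
    using ab cd len by (auto dest: list_all2_lengthD)
  have ab': "list_all2 (\<lambda>a b. (a, b) \<in> \<alpha>) (map fst as) (map fst bs)"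
      "list_all2 (\<lambda>a b. (a, b) \<in> \<mu>) (map snd as) (map snd bs)"
    and cd': "list_all2 (\<lambda>c d. (c, d) \<in> \<beta>) (map fst cs) (map fst ds)"
      "list_all2 (\<lambda>c d. (c, d) \<in> \<nu>) (map snd cs) (map snd ds)"
    using ab cd by (simp_all add: list_all2_conv_all_nth mem_rel_times_iff)
  have "(eval_trm A ((!) (map fst as @ map fst cs)) t, eval_trm A ((!) (map fst as @ map fst ds)) t) \<in> \<gamma> \<longleftrightarrow>
      (eval_trm A ((!) (map fst bs @ map fst cs)) t, eval_trm A ((!) (map fst bs @ map fst ds)) t) \<in> \<gamma>"
    by (rule c[unfolded centralizes_def, rule_format, of t n k])
      (use t len ab'(1) cd'(1) in auto)
  moreover have "(eval_trm M ((!) (map snd as @ map snd cs)) t, eval_trm M ((!) (map snd as @ map snd ds)) t) \<in> \<delta> \<longleftrightarrow>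
      (eval_trm M ((!) (map snd bs @ map snd cs)) t, eval_trm M ((!) (map snd bs @ map snd ds)) t) \<in> \<delta>"
    by (rule d[unfolded centralizes_def, rule_format, of t n k])
      (use t len ab'(2) cd'(2) in auto)
  ultimately show "(eval_trm (prod_algebra A M) ((!) (as @ cs)) t,
        eval_trm (prod_algebra A M) ((!) (as @ ds)) t) \<in> \<gamma> \<otimes>\<^sub>r \<delta> \<longleftrightarrow>
      (eval_trm (prod_algebra A M) ((!) (bs @ cs)) t,
        eval_trm (prod_algebra A M) ((!) (bs @ ds)) t) \<in> \<gamma> \<otimes>\<^sub>r \<delta>"
    using t(2) by (simp add: eval_trm_prod_algebra_nth len len')
qed

text \<open>This settles the coordinate that is filled up with a constant below. Compatibility with
  terms carries \<open>(u, u)\<close> to the value of \<open>t\<close>, and the bound on the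
  variables keeps every index inside the list.\<close>

lemma eval_trm_const_refl:
  assumes "\<delta> \<in> Con \<tau> N" and "wf_trm \<tau> t" and "vars t \<subseteq> {..<n}" and "u \<in> carrier N"
  shows "(eval_trm N ((!) (replicate n u)) t, eval_trm N ((!) (replicate n u)) t) \<in> \<delta>"
  by (rule eval_Con[OF assms(1,2)]) (use assms Con_refl in \<open>auto simp: subset_iff\<close>)

text \<open>All lists over \<open>A\<close> receive the same constant \<open>u\<close> as second
  coordinate. Both values of \<open>t\<close> compared on either side then agree in that coordinate
  and are related by \<delta>, so only the condition in \<open>A\<close> remains.\<close>

lemma centralizes_rel_timesD1:
  fixes A :: "('f, 'a) algebra" and M :: "('f, 'm) algebra"
  assumes M: "is_algebra \<tau> M" and con: "\<mu> \<in> Con \<tau> M" "\<nu> \<in> Con \<tau> M" "\<delta> \<in> Con \<tau> M"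
    and c: "centralizes \<tau> (prod_algebra A M) (\<alpha> \<otimes>\<^sub>r \<mu>) (\<beta> \<otimes>\<^sub>r \<nu>) (\<gamma> \<otimes>\<^sub>r \<delta>)"
  shows "centralizes \<tau> A \<alpha> \<beta> \<gamma>"
  unfolding centralizes_def
proof (intro allI impI, elim conjE)
  fix n k t and as bs cs ds :: "'a list"
  assume t: "wf_trm \<tau> t" "vars t \<subseteq> {..<n + k}" and len: "length as = n" "length cs = k"
    and ab: "list_all2 (\<lambda>a b. (a, b) \<in> \<alpha>) as bs"
    and cd: "list_all2 (\<lambda>c d. (c, d) \<in> \<beta>) cs ds"
  obtain u where u: "u \<in> carrier M" using M unfolding is_algebra_def by blast
  have len': "length bs = n" "length ds = k"
    using ab cd len by (auto dest: list_all2_lengthD)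
  define l where "l = map (\<lambda>a :: 'a. (a, u))"
  have l: "length (l xs) = length xs" "map fst (l xs) = xs" "map snd (l xs) = replicate (length xs) u"
    for xs by (simp_all add: l_def comp_def map_replicate_const)
  have ab': "list_all2 (\<lambda>a b. (a, b) \<in> \<alpha> \<otimes>\<^sub>r \<mu>) (l as) (l bs)"
    and cd': "list_all2 (\<lambda>c d. (c, d) \<in> \<beta> \<otimes>\<^sub>r \<nu>) (l cs) (l ds)"
    using ab cd by (simp_all add: l_def list_all2_conv_all_nth Con_refl[OF con(1) u] Con_refl[OF con(2) u])
  have "(eval_trm (prod_algebra A M) ((!) (l as @ l cs)) t,
        eval_trm (prod_algebra A M) ((!) (l as @ l ds)) t) \<in> \<gamma> \<otimes>\<^sub>r \<delta> \<longleftrightarrow>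
      (eval_trm (prod_algebra A M) ((!) (l bs @ l cs)) t,
        eval_trm (prod_algebra A M) ((!) (l bs @ l ds)) t) \<in> \<gamma> \<otimes>\<^sub>r \<delta>"
    by (rule c[unfolded centralizes_def, rule_format, of t n k]) (use t len l ab' cd' in auto)
  then show "(eval_trm A ((!) (as @ cs)) t, eval_trm A ((!) (as @ ds)) t) \<in> \<gamma> \<longleftrightarrow>
      (eval_trm A ((!) (bs @ cs)) t, eval_trm A ((!) (bs @ ds)) t) \<in> \<gamma>"
    \<comment> \<open>Reversed, \<open>replicate_add\<close> merges the constant blocks of lengths
      \<open>n\<close> and \<open>k\<close> into the single one of
      \<open>eval_trm_const_refl\<close>.\<close>
    using t(2) eval_trm_const_refl[OF con(3) t u]
    by (simp add: eval_trm_prod_algebra_nth len len' l flip: replicate_add)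
qed

text \<open>The mirror image: a constant of \<open>A\<close> fills up the first coordinate, which
  reflexivity of \<gamma> absorbs.\<close>

lemma centralizes_rel_timesD2:
  fixes A :: "('f, 'a) algebra" and M :: "('f, 'm) algebra"
  assumes A: "is_algebra \<tau> A" and con: "\<alpha> \<in> Con \<tau> A" "\<beta> \<in> Con \<tau> A" "\<gamma> \<in> Con \<tau> A"
    and c: "centralizes \<tau> (prod_algebra A M) (\<alpha> \<otimes>\<^sub>r \<mu>) (\<beta> \<otimes>\<^sub>r \<nu>) (\<gamma> \<otimes>\<^sub>r \<delta>)"
  shows "centralizes \<tau> M \<mu> \<nu> \<delta>"
  unfolding centralizes_def
proof (intro allI impI, elim conjE)
  fix n k t and as bs cs ds :: "'m list"
  assume t: "wf_trm \<tau> t" "vars t \<subseteq> {..<n + k}" and len: "length as = n" "length cs = k"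
    and ab: "list_all2 (\<lambda>a b. (a, b) \<in> \<mu>) as bs"
    and cd: "list_all2 (\<lambda>c d. (c, d) \<in> \<nu>) cs ds"
  obtain u where u: "u \<in> carrier A" using A unfolding is_algebra_def by blast
  have len': "length bs = n" "length ds = k"
    using ab cd len by (auto dest: list_all2_lengthD)
  define l where "l = map (\<lambda>a :: 'm. (u, a))"
  have l: "length (l xs) = length xs" "map snd (l xs) = xs" "map fst (l xs) = replicate (length xs) u"
    for xs by (simp_all add: l_def comp_def map_replicate_const)
  have ab': "list_all2 (\<lambda>a b. (a, b) \<in> \<alpha> \<otimes>\<^sub>r \<mu>) (l as) (l bs)"
    and cd': "list_all2 (\<lambda>c d. (c, d) \<in> \<beta> \<otimes>\<^sub>r \<nu>) (l cs) (l ds)"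
    using ab cd by (simp_all add: l_def list_all2_conv_all_nth Con_refl[OF con(1) u] Con_refl[OF con(2) u])
  have "(eval_trm (prod_algebra A M) ((!) (l as @ l cs)) t,
        eval_trm (prod_algebra A M) ((!) (l as @ l ds)) t) \<in> \<gamma> \<otimes>\<^sub>r \<delta> \<longleftrightarrow>
      (eval_trm (prod_algebra A M) ((!) (l bs @ l cs)) t,
        eval_trm (prod_algebra A M) ((!) (l bs @ l ds)) t) \<in> \<gamma> \<otimes>\<^sub>r \<delta>"
    by (rule c[unfolded centralizes_def, rule_format, of t n k]) (use t len l ab' cd' in auto)
  then show "(eval_trm M ((!) (as @ cs)) t, eval_trm M ((!) (as @ ds)) t) \<in> \<delta> \<longleftrightarrow>
      (eval_trm M ((!) (bs @ cs)) t, eval_trm M ((!) (bs @ ds)) t) \<in> \<delta>"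
    using t(2) eval_trm_const_refl[OF con(3) t u]
    by (simp add: eval_trm_prod_algebra_nth len len' l flip: replicate_add)
qed

section \<open>Congruences of a product without skew congruences\<close>

locale skew_free_product =
  fixes \<tau> :: "'f \<rightharpoonup> nat" and A :: "('f, 'a) algebra" and M :: "('f, 'm) algebra"
  assumes A: "is_algebra \<tau> A" and M: "is_algebra \<tau> M" and no_skew: "no_skew \<tau> A M"
begin

abbreviation N :: "('f, 'a \<times> 'm) algebra" where
  "N \<equiv> prod_algebra A M"

lemma Con_prod: "Con \<tau> N = {\<alpha> \<otimes>\<^sub>r \<mu> | \<alpha> \<mu>. \<alpha> \<in> Con \<tau> A \<and> \<mu> \<in> Con \<tau> M}"
  using no_skew unfolding no_skew_def .

lemma Con_prodE:
  assumes "\<theta> \<in> Con \<tau> N"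
  obtains \<alpha> \<mu> where "\<alpha> \<in> Con \<tau> A" "\<mu> \<in> Con \<tau> M" "\<theta> = \<alpha> \<otimes>\<^sub>r \<mu>"
  using assms unfolding Con_prod by blast

text \<open>Congruences on a nonempty carrier contain a reflexive pair, so neither factor on the
  left is empty.\<close>

lemma Con_subset_iff:
  "\<alpha> \<in> Con \<tau> A \<Longrightarrow> \<mu> \<in> Con \<tau> M \<Longrightarrow> \<alpha> \<otimes>\<^sub>r \<mu> \<subseteq> \<beta> \<otimes>\<^sub>r \<nu> \<longleftrightarrow> \<alpha> \<subseteq> \<beta> \<and> \<mu> \<subseteq> \<nu>"
  by (intro rel_times_subset_iff Con_nonempty[OF A] Con_nonempty[OF M])

lemma Con_eq_iff:
  "\<lbrakk>\<alpha> \<in> Con \<tau> A; \<beta> \<in> Con \<tau> A; \<mu> \<in> Con \<tau> M; \<nu> \<in> Con \<tau> M\<rbrakk> \<Longrightarrow>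
    \<alpha> \<otimes>\<^sub>r \<mu> = \<beta> \<otimes>\<^sub>r \<nu> \<longleftrightarrow> \<alpha> = \<beta> \<and> \<mu> = \<nu>"
  by (auto simp: set_eq_subset Con_subset_iff)

text \<open>Every congruence above \<open>Z\<close> is a product, and a product contains
  \<open>Z\<close> iff its factors contain the two projections of \<open>Z\<close>. Taking arbitrary
  \<open>Z\<close>, not only rectangles, serves the principal and the finitely generated case
  alike.\<close>

lemma Cg_prod:
  assumes Z: "Z \<subseteq> carrier N \<times> carrier N"
  shows "Cg \<tau> N Z = Cg \<tau> A (map_prod fst fst ` Z) \<otimes>\<^sub>r Cg \<tau> M (map_prod snd snd ` Z)"
    (is "_ = Cg \<tau> A ?X \<otimes>\<^sub>r Cg \<tau> M ?Y")
proof (rule Cg_eqI)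
  have "?X \<subseteq> carrier A \<times> carrier A" "?Y \<subseteq> carrier M \<times> carrier M" using Z by fastforce+
  then show "Cg \<tau> A ?X \<otimes>\<^sub>r Cg \<tau> M ?Y \<in> Con \<tau> N" by (intro Con_rel_times Cg_in_Con A M)
  have "Z \<subseteq> ?X \<otimes>\<^sub>r ?Y" by (force simp: mem_rel_times_iff)
  also have "\<dots> \<subseteq> Cg \<tau> A ?X \<otimes>\<^sub>r Cg \<tau> M ?Y" by (intro rel_times_mono subset_Cg)
  finally show "Z \<subseteq> Cg \<tau> A ?X \<otimes>\<^sub>r Cg \<tau> M ?Y" .
next
  fix \<phi> assume "\<phi> \<in> Con \<tau> N" and Z\<phi>: "Z \<subseteq> \<phi>"
  then obtain \<alpha> \<mu> where am: "\<alpha> \<in> Con \<tau> A" "\<mu> \<in> Con \<tau> M" "\<phi> = \<alpha> \<otimes>\<^sub>r \<mu>" by (elim Con_prodE)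
  have "?X \<subseteq> \<alpha>" "?Y \<subseteq> \<mu>" using Z\<phi> am(3) by (auto simp: mem_rel_times_iff)
  then show "Cg \<tau> A ?X \<otimes>\<^sub>r Cg \<tau> M ?Y \<subseteq> \<phi>"
    unfolding am(3) by (intro rel_times_mono Cg_least am)
qed

lemma Cg_rel_times:
  assumes "X \<noteq> {}" "X \<subseteq> carrier A \<times> carrier A" "Y \<noteq> {}" "Y \<subseteq> carrier M \<times> carrier M"
  shows "Cg \<tau> N (X \<otimes>\<^sub>r Y) = Cg \<tau> A X \<otimes>\<^sub>r Cg \<tau> M Y"
proof -
  \<comment> \<open>Nonemptiness of each factor is what makes the projection to the other one
    surjective.\<close>
  have "map_prod fst fst ` (X \<otimes>\<^sub>r Y) = X" "map_prod snd snd ` (X \<otimes>\<^sub>r Y) = Y"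
    using assms(1,3) by (force simp: rel_times_def image_iff)+
  moreover have "X \<otimes>\<^sub>r Y \<subseteq> carrier N \<times> carrier N"
    using assms(2,4) by (force simp: rel_times_def)
  ultimately show ?thesis using Cg_prod[of "X \<otimes>\<^sub>r Y"] by simp
qed

text \<open>Upper bounds are themselves products, so they can be compared with the join coordinate
  by coordinate.\<close>

lemma con_join_prod:
  assumes con: "\<alpha> \<in> Con \<tau> A" "\<beta> \<in> Con \<tau> A" "\<mu> \<in> Con \<tau> M" "\<nu> \<in> Con \<tau> M"
  shows "con_join \<tau> N (\<alpha> \<otimes>\<^sub>r \<mu>) (\<beta> \<otimes>\<^sub>r \<nu>) = con_join \<tau> A \<alpha> \<beta> \<otimes>\<^sub>r con_join \<tau> M \<mu> \<nu>"
proof (rule con_join_eqI)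
  show "con_join \<tau> A \<alpha> \<beta> \<otimes>\<^sub>r con_join \<tau> M \<mu> \<nu> \<in> Con \<tau> N"
    by (intro Con_rel_times con_join_in_Con A M con)
next
  fix \<phi> assume p: "\<phi> \<in> Con \<tau> N" "\<alpha> \<otimes>\<^sub>r \<mu> \<subseteq> \<phi>" "\<beta> \<otimes>\<^sub>r \<nu> \<subseteq> \<phi>"
  from p(1) obtain \<gamma> \<delta> where "\<gamma> \<in> Con \<tau> A" "\<delta> \<in> Con \<tau> M" "\<phi> = \<gamma> \<otimes>\<^sub>r \<delta>" by (rule Con_prodE)
  then show "con_join \<tau> A \<alpha> \<beta> \<otimes>\<^sub>r con_join \<tau> M \<mu> \<nu> \<subseteq> \<phi>"
    using p(2,3) con by (simp add: Con_subset_iff con_join_in_Con A M con_join_le_iff)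
qed (intro rel_times_mono con_join_upper)+

text \<open>Injectivity holds because a product of congruences determines its factors; surjectivity
  is the absence of skew congruences.\<close>

lemma Con_lattice_iso:
  "lattice_iso (\<lambda>(\<alpha>, \<mu>). \<alpha> \<otimes>\<^sub>r \<mu>)
    (prod_blattice (Con_lattice \<tau> A) (Con_lattice \<tau> M)) (Con_lattice \<tau> N)"
proof -
  have "bij_betw (\<lambda>(\<alpha>, \<mu>). \<alpha> \<otimes>\<^sub>r \<mu>) (Con \<tau> A \<times> Con \<tau> M) (Con \<tau> N)"
    unfolding bij_betw_def inj_on_def Con_prod by (auto simp: Con_eq_iff image_iff)
  then show ?thesis
    unfolding lattice_iso_def
    by (auto simp: prod_blattice_def Con_lattice_def con_join_prod rel_times_Int
        con_bot_prod con_top_prod)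
qed

text \<open>A pair of elements of the product amounts to one pair from \<open>A\<close> and one from
  \<open>M\<close>, so \<open>Cg_prod\<close> on singletons yields both inclusions.\<close>

lemma PCon_prod: "PCon \<tau> N = {\<alpha> \<otimes>\<^sub>r \<mu> | \<alpha> \<mu>. \<alpha> \<in> PCon \<tau> A \<and> \<mu> \<in> PCon \<tau> M}"
proof -
  have "Cg \<tau> N {((a, u), (b, v))} = Cg \<tau> A {(a, b)} \<otimes>\<^sub>r Cg \<tau> M {(u, v)}"
    if "a \<in> carrier A" "b \<in> carrier A" "u \<in> carrier M" "v \<in> carrier M" for a b u v
    using that Cg_prod[of "{((a, u), (b, v))}"] by simp
  then show ?thesis unfolding PCon_def by (auto; metis)
qed

text \<open>Finite sets of generators are projected in one direction and, once chosen nonempty,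
  multiplied in the other.\<close>

lemma KCon_prod: "KCon \<tau> N = {\<alpha> \<otimes>\<^sub>r \<mu> | \<alpha> \<mu>. \<alpha> \<in> KCon \<tau> A \<and> \<mu> \<in> KCon \<tau> M}"
proof (intro equalityI subsetI)
  fix \<theta> assume "\<theta> \<in> KCon \<tau> N"
  then obtain Z where Z: "finite Z" "Z \<subseteq> carrier N \<times> carrier N" "\<theta> = Cg \<tau> N Z"
    unfolding KCon_def by blast
  have "Cg \<tau> A (map_prod fst fst ` Z) \<in> KCon \<tau> A" "Cg \<tau> M (map_prod snd snd ` Z) \<in> KCon \<tau> M"
    by (rule KConI; use Z in force)+
  then show "\<theta> \<in> {\<alpha> \<otimes>\<^sub>r \<mu> | \<alpha> \<mu>. \<alpha> \<in> KCon \<tau> A \<and> \<mu> \<in> KCon \<tau> M}"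
    using Z(3) Cg_prod[OF Z(2)] by blast
next
  fix \<theta> assume "\<theta> \<in> {\<alpha> \<otimes>\<^sub>r \<mu> | \<alpha> \<mu>. \<alpha> \<in> KCon \<tau> A \<and> \<mu> \<in> KCon \<tau> M}"
  then obtain \<alpha> \<mu> where am: "\<alpha> \<in> KCon \<tau> A" "\<mu> \<in> KCon \<tau> M" "\<theta> = \<alpha> \<otimes>\<^sub>r \<mu>" by blast
  obtain X where X: "finite X" "X \<noteq> {}" "X \<subseteq> carrier A \<times> carrier A" "\<alpha> = Cg \<tau> A X"
    by (rule KCon_nonempty_generators[OF A am(1)])
  obtain Y where Y: "finite Y" "Y \<noteq> {}" "Y \<subseteq> carrier M \<times> carrier M" "\<mu> = Cg \<tau> M Y"
    by (rule KCon_nonempty_generators[OF M am(2)])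
  have "\<theta> = Cg \<tau> N (X \<otimes>\<^sub>r Y)" using am(3) X Y by (simp add: Cg_rel_times)
  moreover have "X \<otimes>\<^sub>r Y \<subseteq> carrier N \<times> carrier N"
    using X(3) Y(3) by (force simp: rel_times_def)
  ultimately show "\<theta> \<in> KCon \<tau> N" using KConI finite_rel_times X(1) Y(1) by metis
qed

section \<open>Commutators, prime congruences and radicals of the product\<close>

lemma commutator_prod:
  assumes con: "\<alpha> \<in> Con \<tau> A" "\<beta> \<in> Con \<tau> A" "\<mu> \<in> Con \<tau> M" "\<nu> \<in> Con \<tau> M"
  shows "commutator \<tau> N (\<alpha> \<otimes>\<^sub>r \<mu>) (\<beta> \<otimes>\<^sub>r \<nu>) = commutator \<tau> A \<alpha> \<beta> \<otimes>\<^sub>r commutator \<tau> M \<mu> \<nu>"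
proof (rule commutator_eqI)
  show "commutator \<tau> A \<alpha> \<beta> \<otimes>\<^sub>r commutator \<tau> M \<mu> \<nu> \<in> Con \<tau> N"
    by (intro Con_rel_times commutator_in_Con A M con)
  show "centralizes \<tau> N (\<alpha> \<otimes>\<^sub>r \<mu>) (\<beta> \<otimes>\<^sub>r \<nu>) (commutator \<tau> A \<alpha> \<beta> \<otimes>\<^sub>r commutator \<tau> M \<mu> \<nu>)"
    by (intro centralizes_rel_times centralizes_commutator)
next
  fix \<phi> assume p: "\<phi> \<in> Con \<tau> N" and c: "centralizes \<tau> N (\<alpha> \<otimes>\<^sub>r \<mu>) (\<beta> \<otimes>\<^sub>r \<nu>) \<phi>"
  from p obtain \<gamma> \<delta> where gd: "\<gamma> \<in> Con \<tau> A" "\<delta> \<in> Con \<tau> M" "\<phi> = \<gamma> \<otimes>\<^sub>r \<delta>" by (rule Con_prodE)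
  \<comment> \<open>Since \<phi> is a product, its term condition separates into one for each
    factor, and each factor contains the corresponding commutator.\<close>
  have "centralizes \<tau> A \<alpha> \<beta> \<gamma>"
    by (rule centralizes_rel_timesD1[OF M con(3,4) gd(2)]) (use c gd(3) in simp)
  moreover have "centralizes \<tau> M \<mu> \<nu> \<delta>"
    by (rule centralizes_rel_timesD2[OF A con(1,2) gd(1)]) (use c gd(3) in simp)
  ultimately show "commutator \<tau> A \<alpha> \<beta> \<otimes>\<^sub>r commutator \<tau> M \<mu> \<nu> \<subseteq> \<phi>"
    unfolding gd(3) by (intro rel_times_mono commutator_least gd)
qed

lemma Spec_prod:
  "Spec \<tau> N = {\<phi> \<otimes>\<^sub>r con_top M | \<phi>. \<phi> \<in> Spec \<tau> A} \<union> {con_top A \<otimes>\<^sub>r \<psi> | \<psi>. \<psi> \<in> Spec \<tau> M}"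
proof -
  note tA = con_top_in_Con[OF A] and tM = con_top_in_Con[OF M]
    and bA = con_bot_in_Con[OF A] and bM = con_bot_in_Con[OF M]
    and topA = Con_subset_con_top[of _ \<tau> A] and topM = Con_subset_con_top[of _ \<tau> M]
  \<comment> \<open>Primeness is rewritten in terms of coordinates: quantifiers over
    \<open>Con \<tau> N\<close> become quantifiers over pairs of factors.\<close>
  have prime_iff: "\<phi> \<otimes>\<^sub>r \<psi> \<in> Spec \<tau> N \<longleftrightarrow> \<not> (\<phi> = con_top A \<and> \<psi> = con_top M) \<and>
      (\<forall>\<alpha>\<in>Con \<tau> A. \<forall>\<mu>\<in>Con \<tau> M. \<forall>\<beta>\<in>Con \<tau> A. \<forall>\<nu>\<in>Con \<tau> M.
        commutator \<tau> A \<alpha> \<beta> \<subseteq> \<phi> \<and> commutator \<tau> M \<mu> \<nu> \<subseteq> \<psi> \<longrightarrow>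
        \<alpha> \<subseteq> \<phi> \<and> \<mu> \<subseteq> \<psi> \<or> \<beta> \<subseteq> \<phi> \<and> \<nu> \<subseteq> \<psi>)" (is "_ \<longleftrightarrow> ?R")
    if p: "\<phi> \<in> Con \<tau> A" "\<psi> \<in> Con \<tau> M" for \<phi> \<psi>
  proof -
    have "(\<forall>\<theta>\<in>Con \<tau> N. P \<theta>) \<longleftrightarrow> (\<forall>\<alpha>\<in>Con \<tau> A. \<forall>\<mu>\<in>Con \<tau> M. P (\<alpha> \<otimes>\<^sub>r \<mu>))" for P
      unfolding Con_prod by blast
    then show ?thesis
      unfolding Spec_def
      by (simp add: p con_top_prod Con_rel_times Con_eq_iff tA tM commutator_prod
          Con_subset_iff commutator_in_Con A M)
  qed
  show ?thesis
  proof (intro equalityI subsetI)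
    fix \<chi> assume chi: "\<chi> \<in> Spec \<tau> N"
    then have "\<chi> \<in> Con \<tau> N" unfolding Spec_def by blast
    then obtain \<phi> \<psi> where p: "\<phi> \<in> Con \<tau> A" "\<psi> \<in> Con \<tau> M" "\<chi> = \<phi> \<otimes>\<^sub>r \<psi>" by (rule Con_prodE)
    note R = chi[unfolded p(3) prime_iff[OF p(1,2)]]
    note prime = R[THEN conjunct2, rule_format]
    have "commutator \<tau> A (con_top A) (con_bot A) \<subseteq> \<phi>"
      using commutator_subset_Int[OF tA bA] con_bot_subset_Con[OF p(1)] by auto
    moreover have "commutator \<tau> M (con_bot M) (con_top M) \<subseteq> \<psi>"
      using commutator_subset_Int[OF bM tM] con_bot_subset_Con[OF p(2)] by auto
    \<comment> \<open>Primeness is tested on \<nabla> \<times> \<Delta> and \<Delta> \<times>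
      \<nabla>, whose commutator lies below \<Delta> \<times> \<Delta>.\<close>
    ultimately have "con_top A \<subseteq> \<phi> \<or> con_top M \<subseteq> \<psi>"
      using prime[OF tA bM bA tM] by blast
    then have "\<phi> = con_top A \<or> \<psi> = con_top M"
      using topA[OF p(1)] topM[OF p(2)] unfolding set_eq_subset by simp
    then show "\<chi> \<in> {\<phi> \<otimes>\<^sub>r con_top M | \<phi>. \<phi> \<in> Spec \<tau> A} \<union> {con_top A \<otimes>\<^sub>r \<psi> | \<psi>. \<psi> \<in> Spec \<tau> M}"
    proof
      assume f: "\<phi> = con_top A"
      \<comment> \<open>With first coordinate \<nabla> throughout, primeness of \<chi> on \<nabla>
        \<times> \<mu> and \<nabla> \<times> \<nu> is a statement about \<open>M\<close>
        alone.\<close>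
      have "\<mu> \<subseteq> \<psi> \<or> \<nu> \<subseteq> \<psi>"
        if "\<mu> \<in> Con \<tau> M" "\<nu> \<in> Con \<tau> M" "commutator \<tau> M \<mu> \<nu> \<subseteq> \<psi>" for \<mu> \<nu>
        using prime[OF tA that(1) tA that(2)] that(3) topA[OF commutator_in_Con[OF A tA tA]] f
        by simp
      then have "\<psi> \<in> Spec \<tau> M" using R f p(2) unfolding Spec_def by simp
      then show ?thesis using p(3) f by blast
    next
      assume f: "\<psi> = con_top M"
      have "\<alpha> \<subseteq> \<phi> \<or> \<beta> \<subseteq> \<phi>"
        if "\<alpha> \<in> Con \<tau> A" "\<beta> \<in> Con \<tau> A" "commutator \<tau> A \<alpha> \<beta> \<subseteq> \<phi>" for \<alpha> \<beta>
        using prime[OF that(1) tM that(2) tM] that(3) topM[OF commutator_in_Con[OF M tM tM]] f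
        by simp
      then have "\<phi> \<in> Spec \<tau> A" using R f p(1) unfolding Spec_def by simp
      then show ?thesis using p(3) f by blast
    qed
  next
    fix \<chi> assume "\<chi> \<in> {\<phi> \<otimes>\<^sub>r con_top M | \<phi>. \<phi> \<in> Spec \<tau> A} \<union> {con_top A \<otimes>\<^sub>r \<psi> | \<psi>. \<psi> \<in> Spec \<tau> M}"
    then show "\<chi> \<in> Spec \<tau> N"
    proof (elim UnE CollectE exE conjE)
      \<comment> \<open>Every congruence of \<open>M\<close> lies below \<nabla>, so
        \<open>prime_iff\<close> reduces to primeness of \<phi>.\<close>
      fix \<phi> assume "\<chi> = \<phi> \<otimes>\<^sub>r con_top M" "\<phi> \<in> Spec \<tau> A"
      then show ?thesis by (simp add: Spec_def[of \<tau> A] prime_iff tM topM)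
    next
      fix \<psi> assume "\<chi> = con_top A \<otimes>\<^sub>r \<psi>" "\<psi> \<in> Spec \<tau> M"
      then show ?thesis by (simp add: Spec_def[of \<tau> M] prime_iff tA topA)
    qed
  qed
qed

text \<open>By \<open>Spec_prod\<close> the primes above the product form two families, each cutting
  down one coordinate only. The term \<open>con_top\<close> in \<open>radical\<close> covers the
  case that a family is empty.\<close>

lemma radical_prod:
  assumes con: "\<alpha> \<in> Con \<tau> A" "\<mu> \<in> Con \<tau> M"
  shows "radical \<tau> N (\<alpha> \<otimes>\<^sub>r \<mu>) = radical \<tau> A \<alpha> \<otimes>\<^sub>r radical \<tau> M \<mu>"
proof -
  have above: "{\<chi> \<in> Spec \<tau> N. \<alpha> \<otimes>\<^sub>r \<mu> \<subseteq> \<chi>} =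
      (\<lambda>\<phi>. \<phi> \<otimes>\<^sub>r con_top M) ` {\<phi> \<in> Spec \<tau> A. \<alpha> \<subseteq> \<phi>} \<union>
      (\<lambda>\<psi>. con_top A \<otimes>\<^sub>r \<psi>) ` {\<psi> \<in> Spec \<tau> M. \<mu> \<subseteq> \<psi>}"
    using Con_subset_con_top[OF con(1)] Con_subset_con_top[OF con(2)]
    unfolding Spec_prod by (auto simp: Con_subset_iff con)
  show ?thesis
    unfolding radical_def con_top_prod above
    by (auto simp: mem_rel_times_iff ball_Un)
qed

section \<open>Radical equivalence and the reticulation of the product\<close>

lemma rad_equiv_prod:
  assumes con: "\<alpha> \<in> Con \<tau> A" "\<beta> \<in> Con \<tau> A" "\<mu> \<in> Con \<tau> M" "\<nu> \<in> Con \<tau> M"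
  shows "rad_equiv \<tau> N (\<alpha> \<otimes>\<^sub>r \<mu>) (\<beta> \<otimes>\<^sub>r \<nu>) \<longleftrightarrow> rad_equiv \<tau> A \<alpha> \<beta> \<and> rad_equiv \<tau> M \<mu> \<nu>"
  unfolding rad_equiv_def radical_prod[OF con(1,3)] radical_prod[OF con(2,4)]
  \<comment> \<open>Radicals are congruences, so equality of their products can be split into
    coordinates.\<close>
  by (rule Con_eq_iff; intro radical_in_Con A M con)

text \<open>The future isomorphism of reticulations. Collecting the factors of all members of a
  class avoids choosing representatives.\<close>

definition class_proj :: "(('a \<times> 'm) \<times> ('a \<times> 'm)) set set \<Rightarrow> ('a \<times> 'a) set set \<times> ('m \<times> 'm) set set" where
  "class_proj X = ({\<alpha> \<in> Con \<tau> A. \<exists>\<mu>\<in>Con \<tau> M. \<alpha> \<otimes>\<^sub>r \<mu> \<in> X}, {\<mu> \<in> Con \<tau> M. \<exists>\<alpha>\<in>Con \<tau> A. \<alpha> \<otimes>\<^sub>r \<mu> \<in> X})"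

lemma class_proj_rad_class:
  assumes con: "\<alpha> \<in> Con \<tau> A" "\<mu> \<in> Con \<tau> M"
  shows "class_proj (rad_class \<tau> N (\<alpha> \<otimes>\<^sub>r \<mu>)) = (rad_class \<tau> A \<alpha>, rad_class \<tau> M \<mu>)"
proof -
  \<comment> \<open>Reflexivity makes \<alpha> and \<mu> themselves the witnesses for the missing
    factor.\<close>
  have "rad_equiv \<tau> A \<alpha> \<alpha>" "rad_equiv \<tau> M \<mu> \<mu>" by (simp_all add: rad_equiv_def)
  then show ?thesis
    unfolding class_proj_def rad_class_def using con
    by (auto simp: Con_rel_times rad_equiv_prod)
qed

lemma reticulation_prod_iso:
  "lattice_iso class_proj (reticulation \<tau> N) (prod_blattice (reticulation \<tau> A) (reticulation \<tau> M))"
proof -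
  note N = is_algebra_prod[OF A M]
  note KA = KCon_in_Con[OF A] and KM = KCon_in_Con[OF M]
  have K: "\<alpha> \<otimes>\<^sub>r \<mu> \<in> KCon \<tau> N" if "\<alpha> \<in> KCon \<tau> A" "\<mu> \<in> KCon \<tau> M" for \<alpha> \<mu>
    using that unfolding KCon_prod by blast
  \<comment> \<open>The type \<open>'b\<close> is generic because the fact is applied to
    \<open>N\<close>, \<open>A\<close> and \<open>M\<close>.\<close>
  have carr: "lcarrier (reticulation \<tau> L) = rad_class \<tau> L ` KCon \<tau> L" for L :: "('f, 'b) algebra"
    by (simp add: reticulation_def)
  have repr: "\<exists>\<alpha>\<in>KCon \<tau> A. \<exists>\<mu>\<in>KCon \<tau> M. X = rad_class \<tau> N (\<alpha> \<otimes>\<^sub>r \<mu>)"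
    if "X \<in> lcarrier (reticulation \<tau> N)" for X
    using that unfolding carr KCon_prod by blast
  have inj: "inj_on class_proj (lcarrier (reticulation \<tau> N))"
  proof (rule inj_onI)
    fix X Y assume XY: "X \<in> lcarrier (reticulation \<tau> N)" "Y \<in> lcarrier (reticulation \<tau> N)"
      and eq: "class_proj X = class_proj Y"
    obtain \<alpha> \<mu> where X: "\<alpha> \<in> KCon \<tau> A" "\<mu> \<in> KCon \<tau> M" "X = rad_class \<tau> N (\<alpha> \<otimes>\<^sub>r \<mu>)"
      using repr[OF XY(1)] by blast
    obtain \<beta> \<nu> where Y: "\<beta> \<in> KCon \<tau> A" "\<nu> \<in> KCon \<tau> M" "Y = rad_class \<tau> N (\<beta> \<otimes>\<^sub>r \<nu>)"
      using repr[OF XY(2)] by blast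
    have con: "\<alpha> \<in> Con \<tau> A" "\<beta> \<in> Con \<tau> A" "\<mu> \<in> Con \<tau> M" "\<nu> \<in> Con \<tau> M" using X Y KA KM by blast+
    have "rad_class \<tau> A \<alpha> = rad_class \<tau> A \<beta>" "rad_class \<tau> M \<mu> = rad_class \<tau> M \<nu>"
      using eq con unfolding X(3) Y(3) by (simp_all add: class_proj_rad_class)
    then show "X = Y" using con unfolding X(3) Y(3)
      by (simp add: rad_class_eq_iff Con_rel_times rad_equiv_prod)
  qed
  have "class_proj ` lcarrier (reticulation \<tau> N) = lcarrier (reticulation \<tau> A) \<times> lcarrier (reticulation \<tau> M)"
  proof -
    have "class_proj ` lcarrier (reticulation \<tau> N) =
        (\<lambda>(\<alpha>, \<mu>). class_proj (rad_class \<tau> N (\<alpha> \<otimes>\<^sub>r \<mu>))) ` (KCon \<tau> A \<times> KCon \<tau> M)"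
      unfolding carr KCon_prod by force
    also have "\<dots> = (\<lambda>(\<alpha>, \<mu>). (rad_class \<tau> A \<alpha>, rad_class \<tau> M \<mu>)) ` (KCon \<tau> A \<times> KCon \<tau> M)"
      by (intro image_cong) (auto simp: class_proj_rad_class KA KM)
    finally show ?thesis unfolding carr by auto
  qed
  with inj have bij: "bij_betw class_proj (lcarrier (reticulation \<tau> N))
      (lcarrier (prod_blattice (reticulation \<tau> A) (reticulation \<tau> M)))"
    by (simp add: bij_betw_def prod_blattice_def)
  have ops: "class_proj (ljoin (reticulation \<tau> N) X Y) =
        ljoin (prod_blattice (reticulation \<tau> A) (reticulation \<tau> M)) (class_proj X) (class_proj Y) \<and>
      class_proj (lmeet (reticulation \<tau> N) X Y) =
        lmeet (prod_blattice (reticulation \<tau> A) (reticulation \<tau> M)) (class_proj X) (class_proj Y)"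
    if XY: "X \<in> lcarrier (reticulation \<tau> N)" "Y \<in> lcarrier (reticulation \<tau> N)" for X Y
  proof -
    obtain \<alpha> \<mu> where X: "\<alpha> \<in> KCon \<tau> A" "\<mu> \<in> KCon \<tau> M" "X = rad_class \<tau> N (\<alpha> \<otimes>\<^sub>r \<mu>)"
      using repr[OF XY(1)] by blast
    obtain \<beta> \<nu> where Y: "\<beta> \<in> KCon \<tau> A" "\<nu> \<in> KCon \<tau> M" "Y = rad_class \<tau> N (\<beta> \<otimes>\<^sub>r \<nu>)"
      using repr[OF XY(2)] by blast
    have con: "\<alpha> \<in> Con \<tau> A" "\<beta> \<in> Con \<tau> A" "\<mu> \<in> Con \<tau> M" "\<nu> \<in> Con \<tau> M" using X Y KA KM by blast+
    \<comment> \<open>Both classes have finitely generated representatives, on which the operations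
      of all three reticulations can be computed; joins and commutators of these are
      coordinatewise.\<close>
    show ?thesis
      unfolding X(3) Y(3)
      by (simp add: reticulation_ljoin[OF N] reticulation_lmeet[OF N] reticulation_ljoin[OF A]
          reticulation_lmeet[OF A] reticulation_ljoin[OF M] reticulation_lmeet[OF M] K X(1,2) Y(1,2)
          con con_join_prod commutator_prod class_proj_rad_class con_join_in_Con commutator_in_Con
          A M prod_blattice_def)
  qed
  have "class_proj (lzero (reticulation \<tau> N)) = lzero (prod_blattice (reticulation \<tau> A) (reticulation \<tau> M))"
    "class_proj (lone (reticulation \<tau> N)) = lone (prod_blattice (reticulation \<tau> A) (reticulation \<tau> M))"
    by (simp_all add: reticulation_def prod_blattice_def con_bot_prod con_top_prod
        class_proj_rad_class con_bot_in_Con con_top_in_Con A M)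
  then show ?thesis unfolding lattice_iso_def using bij ops by blast
qed

end

theorem proposition6p12:
  fixes \<tau> :: "'f \<rightharpoonup> nat"
    and E :: "('f trm \<times> 'f trm) set"
    and A :: "('f, 'a) algebra"
    and M :: "('f, 'm) algebra"
  assumes "is_identities \<tau> E"
    and "A \<in> variety \<tau> E"
    and "commutator_commutative \<tau> A"
    and "commutator_distributive \<tau> A"
    and "con_top A \<in> KCon \<tau> A"
    and "M \<in> variety \<tau> E"
    and "no_skew \<tau> A M"
  shows
    "(\<forall>X Y. X \<noteq> {} \<and> X \<subseteq> carrier A \<times> carrier A \<and> Y \<noteq> {} \<and> Y \<subseteq> carrier M \<times> carrier M \<longrightarrow>
       Cg \<tau> (prod_algebra A M) (X \<otimes>\<^sub>r Y) = Cg \<tau> A X \<otimes>\<^sub>r Cg \<tau> M Y) \<and>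
     lattice_iso (\<lambda>(\<alpha>, \<mu>). \<alpha> \<otimes>\<^sub>r \<mu>)
       (prod_blattice (Con_lattice \<tau> A) (Con_lattice \<tau> M)) (Con_lattice \<tau> (prod_algebra A M)) \<and>
     PCon \<tau> (prod_algebra A M) = {\<alpha> \<otimes>\<^sub>r \<mu> | \<alpha> \<mu>. \<alpha> \<in> PCon \<tau> A \<and> \<mu> \<in> PCon \<tau> M} \<and>
     KCon \<tau> (prod_algebra A M) = {\<alpha> \<otimes>\<^sub>r \<mu> | \<alpha> \<mu>. \<alpha> \<in> KCon \<tau> A \<and> \<mu> \<in> KCon \<tau> M} \<and>
     (congruence_modular \<tau> E \<and> con_top M \<in> KCon \<tau> M \<longrightarrow>
       (\<forall>\<alpha>\<in>Con \<tau> A. \<forall>\<mu>\<in>Con \<tau> M.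
          radical \<tau> (prod_algebra A M) (\<alpha> \<otimes>\<^sub>r \<mu>) = radical \<tau> A \<alpha> \<otimes>\<^sub>r radical \<tau> M \<mu>) \<and>
       (\<forall>\<alpha>\<in>Con \<tau> A. \<forall>\<beta>\<in>Con \<tau> A. \<forall>\<mu>\<in>Con \<tau> M. \<forall>\<nu>\<in>Con \<tau> M.
          rad_equiv \<tau> (prod_algebra A M) (\<alpha> \<otimes>\<^sub>r \<mu>) (\<beta> \<otimes>\<^sub>r \<nu>) \<longleftrightarrow>
          rad_equiv \<tau> A \<alpha> \<beta> \<and> rad_equiv \<tau> M \<mu> \<nu>) \<and>
       (KCon_commutator_closed \<tau> A \<and> KCon_commutator_closed \<tau> M \<longrightarrow>
          lattice_isomorphic (reticulation \<tau> (prod_algebra A M))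
            (prod_blattice (reticulation \<tau> A) (reticulation \<tau> M))))"
proof -
  interpret skew_free_product \<tau> A M
    using assms unfolding variety_def by unfold_locales blast+
  have iso: "lattice_isomorphic (reticulation \<tau> N) (prod_blattice (reticulation \<tau> A) (reticulation \<tau> M))"
    using reticulation_prod_iso unfolding lattice_isomorphic_def by (rule exI[of _ class_proj])
  show ?thesis
    \<comment> \<open>Each conjunct is now an instance of one lemma of the locale, with its premises
      among the assumptions.\<close>
    by (intro conjI impI allI ballI; (elim conjE)?;
        rule Cg_rel_times Con_lattice_iso PCon_prod KCon_prod radical_prod rad_equiv_prod iso;
        assumption)
qed

end
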